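(* Let $\mathcal T=(V,E)$ be a directed tree and let $S_{\boldsymbol\lambda}$ be a weighted shift on $\mathcal T$ with weights $\boldsymbol\lambda=\{\lambda_v\}_{v\in V^\circ}\subseteq\mathbb C$. Then for every $c\in\mathbb R$ there exists a family $\boldsymbol\theta=\{\theta_u\}_{u\in V}\subseteq\mathbb R$ such that $$e^{-itN}S_{\boldsymbol\lambda}e^{itN}=e^{itc}S_{\boldsymbol\lambda},\qquad t\in\mathbb R$$ (equality of operators, including domains), where $N=N_{\boldsymbol\theta}$ is the unique selfadjoint operator in $\ell^2(V)$ such that $e_u\in\mathcal D(N)$ and $Ne_u=\theta_ue_u$ for all $u\in V$.
   Context: A directed tree $\mathcal T=(V,E)$ consists of a nonempty set $V$ (of arbitrary cardinality) of vertices and a set $E\subseteq V\times V\setminus\{(v,v):v\in V\}$ of edges such that: (1) any two distinct vertices $u,v$ are joined by an undirected path, i.e. there are $v_1=u,\dots,v_n=v$ in $V$ ($n\ge 2$) with $(v_j,v_{j+1})\in E$ or $(v_{j+1},v_j)\in E$ for each $j<n$; (2) there is no circuit, i.e. no finite sequence of distinct vertices $u_1,\dots,u_n$ ($n\ge2$) with $(u_j,u_{j+1})\in E$ for $j<n$ and $(u_n,u_1)\in E$; (3) every vertex $v$ that is not a root has a unique vertex $\operatorname{par}(v)$ (its parent) with $(\operatorname{par}(v),v)\in E$; a root is a vertex $v$ for which there is no $u$ with $(u,v)\in E$. A directed tree has at most one root, denoted $\mathrm{root}$ when it exists. $V^\circ$ is $V$ with the root removed (and $V^\circ=V$ if $\mathcal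 T$ has no root). $\ell^2(V)$ is the Hilbert space of square summable complex functions on $V$, with orthonormal basis $\{e_u\}_{u\in V}$, $e_u$ being the indicator function of $\{u\}$. For $\boldsymbol\lambda=\{\lambda_v\}_{v\in V^\circ}\subseteq\mathbb C$ and $f\colon V\to\mathbb C$ put $(\Lambda f)(v)=\lambda_v f(\operatorname{par}(v))$ for $v\in V^\circ$ and $(\Lambda f)(\mathrm{root})=0$. The weighted shift $S_{\boldsymbol\lambda}$ is the (possibly unbounded, not necessarily densely defined) operator in $\ell^2(V)$ with domain $\mathcal D(S_{\boldsymbol\lambda})=\{f\in\ell^2(V):\Lambda f\in\ell^2(V)\}$ and $S_{\boldsymbol\lambda}f=\Lambda f$. *)

theory Defs
  imports "HOL-Analysis.Analysis"
begin

definition is_root :: "'v set \<Rightarrow> ('v \<times> 'v) set \<Rightarrow> 'v \<Rightarrow> bool" where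
  "is_root V E v \<longleftrightarrow> v \<in> V \<and> (\<nexists>u. (u, v) \<in> E)"

definition directed_tree :: "'v set \<Rightarrow> ('v \<times> 'v) set \<Rightarrow> bool" where
  "directed_tree V E \<longleftrightarrow>
     V \<noteq> {} \<and> E \<subseteq> V \<times> V - {(v, v) |v. v \<in> V} \<and>
     (\<forall>u\<in>V. \<forall>v\<in>V. u \<noteq> v \<longrightarrow>
        (\<exists>p. length p \<ge> 2 \<and> set p \<subseteq> V \<and> hd p = u \<and> last p = v \<and>
             (\<forall>j. Suc j < length p \<longrightarrow> (p ! j, p ! Suc j) \<in> E \<or> (p ! Suc j, p ! j) \<in> E))) \<and>
     \<not> (\<exists>p. length p \<ge> 2 \<and> distinct p \<and>
             (\<forall>j. Suc j < length p \<longrightarrow> (p ! j, p ! Suc j) \<in> E) \<and> (last p, hd p) \<in> E) \<and>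
     (\<forall>v\<in>V. \<not> is_root V E v \<longrightarrow> (\<exists>!u. (u, v) \<in> E))"

definition par :: "('v \<times> 'v) set \<Rightarrow> 'v \<Rightarrow> 'v" where
  "par E v = (THE u. (u, v) \<in> E)"

definition nonroots :: "'v set \<Rightarrow> ('v \<times> 'v) set \<Rightarrow> 'v set" where
  "nonroots V E = {v \<in> V. \<not> is_root V E v}"

text \<open>A function on \<open>V\<close> is represented by its extension by zero to the whole type, so that
  equality of functions on \<open>V\<close> is equality in the logic.\<close>

definition l2 :: "'v set \<Rightarrow> ('v \<Rightarrow> complex) set" where
  "l2 V = {f. (\<forall>v. v \<notin> V \<longrightarrow> f v = 0) \<and> (\<lambda>v. (cmod (f v))\<^sup>2) summable_on V}"

definition l2_inner :: "'v set \<Rightarrow> ('v \<Rightarrow> complex) \<Rightarrow> ('v \<Rightarrow> complex) \<Rightarrow> complex" where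
  "l2_inner V f g = (\<Sum>\<^sub>\<infinity>v\<in>V. f v * cnj (g v))"

definition l2_norm :: "'v set \<Rightarrow> ('v \<Rightarrow> complex) \<Rightarrow> real" where
  "l2_norm V f = sqrt (\<Sum>\<^sub>\<infinity>v\<in>V. (cmod (f v))\<^sup>2)"

definition basis_vec :: "'v \<Rightarrow> 'v \<Rightarrow> complex" where
  "basis_vec u = indicator {u}"

text \<open>A possibly unbounded operator \<open>T\<close> is a partial map with domain \<open>dom T\<close>. Equality of
  such maps is equality of operators including domains, and \<open>A \<circ>\<^sub>m B\<close> is the operator product
  with its natural domain.\<close>

type_synonym 'v operator = "('v \<Rightarrow> complex) \<rightharpoonup> ('v \<Rightarrow> complex)"

definition linear_operator :: "'v set \<Rightarrow> 'v operator \<Rightarrow> bool" where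
  "linear_operator V T \<longleftrightarrow>
     dom T \<subseteq> l2 V \<and> ran T \<subseteq> l2 V \<and> (\<lambda>_. 0) \<in> dom T \<and>
     (\<forall>f\<in>dom T. \<forall>g\<in>dom T. T (\<lambda>v. f v + g v) = Some (\<lambda>v. the (T f) v + the (T g) v)) \<and>
     (\<forall>a. \<forall>f\<in>dom T. T (\<lambda>v. a * f v) = Some (\<lambda>v. a * the (T f) v))"

definition densely_defined :: "'v set \<Rightarrow> 'v operator \<Rightarrow> bool" where
  "densely_defined V T \<longleftrightarrow>
     (\<forall>f\<in>l2 V. \<forall>e>0. \<exists>g\<in>dom T. l2_norm V (\<lambda>v. f v - g v) < e)"

text \<open>The adjoint is meaningful only for densely defined \<open>T\<close>, where the \<open>h\<close> below is unique.\<close>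

definition adjoint_op :: "'v set \<Rightarrow> 'v operator \<Rightarrow> 'v operator" where
  "adjoint_op V T = (\<lambda>g.
     if g \<in> l2 V \<and> (\<exists>h\<in>l2 V. \<forall>f\<in>dom T. l2_inner V (the (T f)) g = l2_inner V f h)
     then Some (THE h. h \<in> l2 V \<and> (\<forall>f\<in>dom T. l2_inner V (the (T f)) g = l2_inner V f h))
     else None)"

definition selfadjoint :: "'v set \<Rightarrow> 'v operator \<Rightarrow> bool" where
  "selfadjoint V T \<longleftrightarrow> linear_operator V T \<and> densely_defined V T \<and> adjoint_op V T = T"

definition scale_op :: "complex \<Rightarrow> 'v operator \<Rightarrow> 'v operator" where
  "scale_op a T = (\<lambda>f. map_option (\<lambda>g v. a * g v) (T f))"

definition orth_projection :: "'v set \<Rightarrow> 'v operator \<Rightarrow> bool" where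
  "orth_projection V P \<longleftrightarrow> selfadjoint V P \<and> dom P = l2 V \<and> P \<circ>\<^sub>m P = P"

definition spectral_measure :: "'v set \<Rightarrow> (real set \<Rightarrow> 'v operator) \<Rightarrow> bool" where
  "spectral_measure V P \<longleftrightarrow>
     (\<forall>B\<in>sets borel. orth_projection V (P B)) \<and>
     (\<forall>f\<in>l2 V. P UNIV f = Some f) \<and>
     (\<forall>B::nat \<Rightarrow> real set. range B \<subseteq> sets borel \<longrightarrow> disjoint_family B \<longrightarrow>
        (\<forall>f\<in>l2 V. (\<lambda>n. l2_norm V (\<lambda>v. (\<Sum>k<n. the (P (B k) f) v) - the (P (\<Union>k. B k) f) v))
                      \<longlonglongrightarrow> 0))"

definition scalar_measure ::
    "'v set \<Rightarrow> (real set \<Rightarrow> 'v operator) \<Rightarrow> ('v \<Rightarrow> complex) \<Rightarrow> real measure" where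
  "scalar_measure V P f =
     measure_of UNIV (sets borel) (\<lambda>B. ennreal (Re (l2_inner V (the (P B f)) f)))"

text \<open>\<open>T\<close> is the integral of \<open>\<phi>\<close> with respect to \<open>P\<close>: its domain is
  \<open>{f. \<integral>\<bar>\<phi>\<bar>\<^sup>2 d\<langle>P(\<cdot>)f, f\<rangle> < \<infinity>}\<close>, and there \<open>\<langle>T f, f\<rangle> = \<integral>\<phi> d\<langle>P(\<cdot>)f, f\<rangle>\<close>. By polarization
  and density of the domain, the quadratic form determines the linear operator \<open>T\<close>.\<close>

definition is_spectral_integral ::
    "'v set \<Rightarrow> (real set \<Rightarrow> 'v operator) \<Rightarrow> (real \<Rightarrow> complex) \<Rightarrow> 'v operator \<Rightarrow> bool" where
  "is_spectral_integral V P \<phi> T \<longleftrightarrow>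
     linear_operator V T \<and>
     dom T = {f \<in> l2 V. integrable (scalar_measure V P f) (\<lambda>x. (cmod (\<phi> x))\<^sup>2)} \<and>
     (\<forall>f\<in>dom T. l2_inner V (the (T f)) f = (\<integral>x. \<phi> x \<partial>scalar_measure V P f))"

text \<open>Intended for selfadjoint \<open>A\<close> and Borel \<open>\<phi>\<close>: by the spectral theorem there is exactly one
  spectral measure \<open>P\<close> (up to its values off the Borel sets) with \<open>A = \<integral>x dP(x)\<close>.\<close>

definition borel_calculus ::
    "'v set \<Rightarrow> (real \<Rightarrow> complex) \<Rightarrow> 'v operator \<Rightarrow> 'v operator" where
  "borel_calculus V \<phi> A =
     (THE T. \<exists>P. spectral_measure V P \<and> is_spectral_integral V P of_real A \<and>
                 is_spectral_integral V P \<phi> T)"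

definition exp_op :: "'v set \<Rightarrow> complex \<Rightarrow> 'v operator \<Rightarrow> 'v operator" where
  "exp_op V z A = borel_calculus V (\<lambda>x. exp (z * of_real x)) A"

definition shift_fun ::
    "'v set \<Rightarrow> ('v \<times> 'v) set \<Rightarrow> ('v \<Rightarrow> complex) \<Rightarrow> ('v \<Rightarrow> complex) \<Rightarrow> 'v \<Rightarrow> complex" where
  "shift_fun V E w f v = (if v \<in> nonroots V E then w v * f (par E v) else 0)"

definition weighted_shift ::
    "'v set \<Rightarrow> ('v \<times> 'v) set \<Rightarrow> ('v \<Rightarrow> complex) \<Rightarrow> 'v operator" where
  "weighted_shift V E w =
     (\<lambda>f. if f \<in> l2 V \<and> shift_fun V E w f \<in> l2 V then Some (shift_fun V E w f) else None)"

definition selfadjoint_diagonal :: "'v set \<Rightarrow> ('v \<Rightarrow> real) \<Rightarrow> 'v operator \<Rightarrow> bool" where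
  "selfadjoint_diagonal V \<theta> N \<longleftrightarrow>
     selfadjoint V N \<and>
     (\<forall>u\<in>V. N (basis_vec u) = Some (\<lambda>v. of_real (\<theta> u) * basis_vec u v))"

end

theory Submission
  imports Defs
begin

text \<open>A directed tree carries an integer level function increasing by one from a vertex to its
  children, because any two vertices have a common ancestor and there are no circuits. With
  \<open>\<theta> = - c * level\<close> we get \<open>\<theta> (par v) - \<theta> v = c\<close>, and conjugating by the diagonal unitary
  \<open>exp (i t \<theta>)\<close> multiplies \<open>S\<close> by \<open>exp (i t (\<theta> (par v) - \<theta> v)) = exp (i t c)\<close>.

  The exponential is defined through a spectral measure of \<open>N\<close>, so one must show that every
  spectral measure \<open>P\<close> with \<open>N = \<integral>x dP\<close> is the obvious one, \<open>P(B) f = (indicator B \<circ> \<theta>) f\<close>. For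
  this it suffices that the scalar measure of each \<open>e\<^sub>u\<close> is concentrated at \<open>\<theta> u\<close>.\<close>


section \<open>Square summable functions and multiplication operators\<close>

lemma l2_zero_outside: "f \<in> l2 V \<Longrightarrow> v \<notin> V \<Longrightarrow> f v = 0"
  by (simp add: l2_def)

lemma l2_summable: "f \<in> l2 V \<Longrightarrow> (\<lambda>v. (cmod (f v))\<^sup>2) summable_on V"
  by (simp add: l2_def)

lemma l2_dominated:
  assumes "f \<in> l2 V" "\<And>v. v \<in> V \<Longrightarrow> cmod (g v) \<le> C * cmod (f v)" "\<And>v. v \<notin> V \<Longrightarrow> g v = 0"
  shows "g \<in> l2 V"
proof -
  have "(\<lambda>v. C\<^sup>2 * (cmod (f v))\<^sup>2) summable_on V"
    using l2_summable[OF assms(1)] by (rule summable_on_cmult_right)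
  then have "(\<lambda>v. (cmod (g v))\<^sup>2) summable_on V"
    by (rule summable_on_comparison_test)
      (use power_mono[OF assms(2), of _ 2] in \<open>auto simp: power_mult_distrib\<close>)
  with assms(3) show ?thesis
    by (simp add: l2_def)
qed

lemma l2_zero: "(\<lambda>_. 0) \<in> l2 V"
  by (simp add: l2_def)

lemma l2_scale: "f \<in> l2 V \<Longrightarrow> (\<lambda>v. a * f v) \<in> l2 V"
  by (rule l2_dominated[where C = "cmod a"]) (auto simp: norm_mult l2_zero_outside)

lemma l2_add:
  assumes "f \<in> l2 V" "g \<in> l2 V"
  shows "(\<lambda>v. f v + g v) \<in> l2 V"
proof -
  have "(\<lambda>v. 2 * (cmod (f v))\<^sup>2 + 2 * (cmod (g v))\<^sup>2) summable_on V"
    by (intro summable_on_add summable_on_cmult_right l2_summable assms)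
  moreover have "(cmod (f v + g v))\<^sup>2 \<le> 2 * (cmod (f v))\<^sup>2 + 2 * (cmod (g v))\<^sup>2" for v
  proof -
    have "(cmod (f v + g v))\<^sup>2 \<le> (cmod (f v) + cmod (g v))\<^sup>2"
      by (intro power_mono norm_triangle_ineq) auto
    also have "\<dots> \<le> 2 * (cmod (f v))\<^sup>2 + 2 * (cmod (g v))\<^sup>2"
      using sum_squares_bound[of "cmod (f v)" "cmod (g v)"]
      by (simp add: power2_sum)
    finally show ?thesis .
  qed
  ultimately have "(\<lambda>v. (cmod (f v + g v))\<^sup>2) summable_on V"
    by (auto intro: summable_on_comparison_test)
  with assms show ?thesis
    by (simp add: l2_def)
qed

lemma l2_diff: "f \<in> l2 V \<Longrightarrow> g \<in> l2 V \<Longrightarrow> (\<lambda>v. f v - g v) \<in> l2 V"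
  using l2_add[OF _ l2_scale[of g V "-1"], of f] by simp

lemma l2_sum: "(\<And>k. k < (n::nat) \<Longrightarrow> f k \<in> l2 V) \<Longrightarrow> (\<lambda>v. \<Sum>k<n. f k v) \<in> l2 V"
  by (induction n) (simp_all add: l2_zero l2_add)

lemma l2_finite_support:
  assumes "finite F" "F \<subseteq> V" "\<And>v. v \<notin> F \<Longrightarrow> f v = 0"
  shows "f \<in> l2 V"
proof -
  have "(\<lambda>v. (cmod (f v))\<^sup>2) summable_on F"
    using assms(1) by simp
  then have "(\<lambda>v. (cmod (f v))\<^sup>2) summable_on V"
    by (rule summable_on_cong_neutral[THEN iffD1, rotated -1]) (use assms in auto)
  with assms show ?thesis
    by (auto simp: l2_def)
qed

lemma basis_vec_l2: "u \<in> V \<Longrightarrow> basis_vec u \<in> l2 V"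
  by (rule l2_finite_support[of "{u}"]) (auto simp: basis_vec_def)

section \<open>Inner product and norm on \<open>l2 V\<close>\<close>

lemma l2_inner_abs_summable:
  assumes "f \<in> l2 V" "g \<in> l2 V"
  shows "(\<lambda>v. cmod (f v) * cmod (g v)) summable_on V"
proof -
  have "(\<lambda>v. (cmod (f v))\<^sup>2 + (cmod (g v))\<^sup>2) summable_on V"
    by (intro summable_on_add l2_summable assms)
  moreover have "cmod (f v) * cmod (g v) \<le> (cmod (f v))\<^sup>2 + (cmod (g v))\<^sup>2" for v
    using sum_squares_bound[of "cmod (f v)" "cmod (g v)"]
      mult_nonneg_nonneg[OF norm_ge_zero norm_ge_zero, of "f v" "g v"] by linarith
  ultimately show ?thesis
    by (auto intro: summable_on_comparison_test)
qed

lemma l2_inner_summable: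
  assumes "f \<in> l2 V" "g \<in> l2 V"
  shows "(\<lambda>v. f v * cnj (g v)) summable_on V"
  by (rule abs_summable_summable) (use l2_inner_abs_summable[OF assms] in \<open>simp add: norm_mult\<close>)

lemma l2_inner_add_left:
  "f \<in> l2 V \<Longrightarrow> g \<in> l2 V \<Longrightarrow> h \<in> l2 V \<Longrightarrow>
    l2_inner V (\<lambda>v. f v + g v) h = l2_inner V f h + l2_inner V g h"
  unfolding l2_inner_def distrib_right by (intro infsum_add l2_inner_summable)

lemma l2_inner_add_right:
  "f \<in> l2 V \<Longrightarrow> g \<in> l2 V \<Longrightarrow> h \<in> l2 V \<Longrightarrow>
    l2_inner V h (\<lambda>v. f v + g v) = l2_inner V h f + l2_inner V h g"
  unfolding l2_inner_def complex_cnj_add distrib_left by (intro infsum_add l2_inner_summable)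

lemma l2_inner_scale_left: "l2_inner V (\<lambda>v. a * f v) h = a * l2_inner V f h"
  unfolding l2_inner_def mult.assoc by (rule infsum_cmult_right')

lemma l2_inner_scale_right: "l2_inner V f (\<lambda>v. a * h v) = cnj a * l2_inner V f h"
  unfolding l2_inner_def by (simp add: mult.left_commute[of _ "cnj a"] infsum_cmult_right')

lemma l2_inner_diff_left:
  "f \<in> l2 V \<Longrightarrow> g \<in> l2 V \<Longrightarrow> h \<in> l2 V \<Longrightarrow>
    l2_inner V (\<lambda>v. f v - g v) h = l2_inner V f h - l2_inner V g h"
  using l2_inner_add_left[OF _ l2_scale[of g V "-1"], of f h] l2_inner_scale_left[of V "-1" g h]
  by simp

lemma l2_inner_sum_left:
  "(\<And>k. k < (n::nat) \<Longrightarrow> f k \<in> l2 V) \<Longrightarrow> h \<in> l2 V \<Longrightarrow>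
    l2_inner V (\<lambda>v. \<Sum>k<n. f k v) h = (\<Sum>k<n. l2_inner V (f k) h)"
proof (induction n)
  case 0
  then show ?case by (simp add: l2_inner_def)
next
  case (Suc n)
  then show ?case by (simp add: l2_inner_add_left l2_sum)
qed

lemma l2_inner_commute: "l2_inner V g f = cnj (l2_inner V f g)"
  unfolding l2_inner_def infsum_cnj[symmetric] by (simp add: mult.commute)

lemma l2_inner_basis_right:
  assumes "u \<in> V"
  shows "l2_inner V f (basis_vec u) = f u"
proof -
  have "l2_inner V f (basis_vec u) = (\<Sum>\<^sub>\<infinity>v\<in>{u}. f v * cnj (basis_vec u v))"
    unfolding l2_inner_def by (rule infsum_cong_neutral) (use assms in \<open>auto simp: basis_vec_def\<close>)
  then show ?thesis
    by (simp add: basis_vec_def)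
qed

lemma l2_inner_basis_left: "u \<in> V \<Longrightarrow> l2_inner V (basis_vec u) f = cnj (f u)"
  by (subst l2_inner_commute) (simp add: l2_inner_basis_right)

lemma l2_norm_nonneg: "0 \<le> l2_norm V f"
  by (simp add: l2_norm_def infsum_nonneg)

lemma l2_norm_squared: "(l2_norm V f)\<^sup>2 = (\<Sum>\<^sub>\<infinity>v\<in>V. (cmod (f v))\<^sup>2)"
  by (simp add: l2_norm_def infsum_nonneg)

lemma l2_inner_self:
  assumes "f \<in> l2 V"
  shows "l2_inner V f f = of_real ((l2_norm V f)\<^sup>2)"
  unfolding l2_inner_def l2_norm_squared complex_norm_square[symmetric]
  by (rule infsumI has_sum_of_real has_sum_infsum l2_summable assms)+

lemma l2_norm_eq_0_D:
  assumes "f \<in> l2 V" "l2_norm V f = 0"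
  shows "f = (\<lambda>_. 0)"
proof
  fix v
  show "f v = 0"
  proof (cases "v \<in> V")
    case True
    have "(\<Sum>\<^sub>\<infinity>v\<in>V. (cmod (f v))\<^sup>2) = 0"
      using assms(2) by (simp flip: l2_norm_squared)
    then have "(cmod (f v))\<^sup>2 = 0"
      by (intro nonneg_infsum_le_0D[of "\<lambda>v. (cmod (f v))\<^sup>2" V])
        (use assms True in \<open>auto simp: l2_summable\<close>)
    then show ?thesis by simp
  qed (use assms in \<open>simp add: l2_zero_outside\<close>)
qed

lemma l2_cauchy_schwarz:
  assumes "f \<in> l2 V" "g \<in> l2 V"
  shows "cmod (l2_inner V f g) \<le> l2_norm V f * l2_norm V g"
proof (cases "l2_norm V f = 0 \<or> l2_norm V g = 0")
  case True
  then have "l2_inner V f g = 0"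
    using l2_norm_eq_0_D[OF assms(1)] l2_norm_eq_0_D[OF assms(2)] by (auto simp: l2_inner_def)
  then show ?thesis
    by (simp add: l2_norm_nonneg)
next
  case False
  \<comment> \<open>With this ratio the bound \<open>ab <= (s/2) a^2 + (1/(2s)) b^2\<close> is sharp
    after summation: each of the two terms becomes half of
    \<open>l2_norm V f * l2_norm V g\<close>.\<close>
  define s where "s = l2_norm V g / l2_norm V f"
  have s: "s > 0" and pos: "l2_norm V f > 0" "l2_norm V g > 0"
    using False l2_norm_nonneg[of V f] l2_norm_nonneg[of V g] by (auto simp: s_def)
  have young: "cmod (f v) * cmod (g v) \<le> (s / 2) * (cmod (f v))\<^sup>2 + (1 / (2 * s)) * (cmod (g v))\<^sup>2" for v
  proof -
    have "0 \<le> (s * cmod (f v) - cmod (g v))\<^sup>2 / (2 * s)"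
      using s by simp
    also have "\<dots> = (s / 2) * (cmod (f v))\<^sup>2 + (1 / (2 * s)) * (cmod (g v))\<^sup>2 - cmod (f v) * cmod (g v)"
      using s by (simp add: power2_eq_square field_simps)
    finally show ?thesis by simp
  qed
  have sums: "(\<lambda>v. (s / 2) * (cmod (f v))\<^sup>2) summable_on V" "(\<lambda>v. (1 / (2 * s)) * (cmod (g v))\<^sup>2) summable_on V"
    by (intro summable_on_cmult_right l2_summable assms)+
  have "cmod (l2_inner V f g) \<le> (\<Sum>\<^sub>\<infinity>v\<in>V. cmod (f v * cnj (g v)))"
    unfolding l2_inner_def
    by (rule norm_infsum_bound) (use l2_inner_abs_summable[OF assms] in \<open>simp add: norm_mult\<close>)
  also have "\<dots> \<le> (\<Sum>\<^sub>\<infinity>v\<in>V. (s / 2) * (cmod (f v))\<^sup>2 + (1 / (2 * s)) * (cmod (g v))\<^sup>2)"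
    using l2_inner_abs_summable[OF assms] young
    by (intro infsum_mono summable_on_add sums) (simp_all add: norm_mult)
  also have "\<dots> = (s / 2) * (l2_norm V f)\<^sup>2 + (1 / (2 * s)) * (l2_norm V g)\<^sup>2"
    unfolding l2_norm_squared infsum_add[OF sums] infsum_cmult_right' ..
  also have "\<dots> = l2_norm V f * l2_norm V g"
    using pos by (simp add: s_def power2_eq_square field_simps)
  finally show ?thesis .
qed

text \<open>The domain is maximal, which is what makes the operator selfadjoint for real
  \<open>m\<close>. The operator \<open>N\<close>, its spectral projections and its exponentials all
  turn out to have this form.\<close>

definition mult_op :: "'v set \<Rightarrow> ('v \<Rightarrow> complex) \<Rightarrow> 'v operator" where
  "mult_op V m =
     (\<lambda>f. if f \<in> l2 V \<and> (\<lambda>v. m v * f v) \<in> l2 V then Some (\<lambda>v. m v * f v) else None)"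

lemma dom_mult_op: "dom (mult_op V m) = {f \<in> l2 V. (\<lambda>v. m v * f v) \<in> l2 V}"
  by (auto simp: mult_op_def dom_def)

lemma mult_op_eq_Some: "f \<in> dom (mult_op V m) \<Longrightarrow> mult_op V m f = Some (\<lambda>v. m v * f v)"
  by (simp add: dom_mult_op) (simp add: mult_op_def)

lemma dom_mult_op_bounded:
  assumes "\<And>v. v \<in> V \<Longrightarrow> cmod (m v) \<le> C"
  shows "dom (mult_op V m) = l2 V"
proof -
  have "(\<lambda>v. m v * f v) \<in> l2 V" if "f \<in> l2 V" for f
    by (rule l2_dominated[OF that, of _ C])
      (use that assms in \<open>auto simp: norm_mult l2_zero_outside intro: mult_right_mono\<close>)
  then show ?thesis
    by (auto simp: dom_mult_op)
qed

lemma finite_support_dom_mult_op: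
  assumes "finite F" "F \<subseteq> V" "\<And>v. v \<notin> F \<Longrightarrow> f v = 0"
  shows "f \<in> dom (mult_op V m)"
  unfolding dom_mult_op mem_Collect_eq
  by (intro conjI; rule l2_finite_support[OF assms(1,2)]; simp add: assms(3))

lemma basis_vec_dom_mult_op: "u \<in> V \<Longrightarrow> basis_vec u \<in> dom (mult_op V m)"
  by (rule finite_support_dom_mult_op[of "{u}"]) (auto simp: basis_vec_def)

lemma linear_mult_op: "linear_operator V (mult_op V m)"
  unfolding linear_operator_def
proof (intro conjI ballI allI)
  show "ran (mult_op V m) \<subseteq> l2 V"
    by (auto simp: mult_op_def ran_def split: if_splits)
next
  fix f g assume "f \<in> dom (mult_op V m)" "g \<in> dom (mult_op V m)"
  then have "(\<lambda>v. f v + g v) \<in> dom (mult_op V m)"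
    by (simp add: dom_mult_op distrib_left l2_add)
  then show "mult_op V m (\<lambda>v. f v + g v)
      = Some (\<lambda>v. the (mult_op V m f) v + the (mult_op V m g) v)"
    using \<open>f \<in> _\<close> \<open>g \<in> _\<close> by (simp add: mult_op_eq_Some distrib_left)
next
  fix a f assume "f \<in> dom (mult_op V m)"
  then have "(\<lambda>v. a * f v) \<in> dom (mult_op V m)"
    using l2_scale[of "\<lambda>v. m v * f v" V a] l2_scale[of f V a]
    by (simp add: dom_mult_op mult.left_commute)
  then show "mult_op V m (\<lambda>v. a * f v) = Some (\<lambda>v. a * the (mult_op V m f) v)"
    using \<open>f \<in> _\<close> by (simp add: mult_op_eq_Some mult.left_commute)
qed (auto simp: dom_mult_op l2_zero)

lemma densely_defined_mult_op: "densely_defined V (mult_op V m)"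
  unfolding densely_defined_def
proof (intro ballI allI impI)
  fix f :: "'a \<Rightarrow> complex" and e :: real
  assume f: "f \<in> l2 V" and e: "e > 0"
  let ?q = "\<lambda>v. (cmod (f v))\<^sup>2"
  \<comment> \<open>The margin is \<open>e\<^sup>2 / 2\<close> because the approximation is
    non-strict while the final estimate has to be strict.\<close>
  obtain F where F: "finite F" "F \<subseteq> V" "dist (sum ?q F) (infsum ?q V) \<le> e\<^sup>2 / 2"
    using infsum_finite_approximation[OF l2_summable[OF f], of "e\<^sup>2 / 2"] e by auto
  define g where "g v = (if v \<in> F then f v else 0)" for v
  have "(\<Sum>\<^sub>\<infinity>v\<in>V. (cmod (f v - g v))\<^sup>2) = infsum ?q (V - F)"
    by (rule infsum_cong_neutral) (auto simp: g_def)
  also have "\<dots> = infsum ?q V - sum ?q F"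
    using F l2_summable[OF f] by (subst infsum_Diff) auto
  also have "\<dots> < e\<^sup>2"
    using F(3) zero_less_power[OF e, of 2] unfolding dist_real_def by linarith
  finally have "l2_norm V (\<lambda>v. f v - g v) < e"
    unfolding l2_norm_def using e by (simp add: real_less_lsqrt infsum_nonneg)
  moreover have "g \<in> dom (mult_op V m)"
    by (rule finite_support_dom_mult_op[OF F(1,2)]) (simp add: g_def)
  ultimately show "\<exists>g\<in>dom (mult_op V m). l2_norm V (\<lambda>v. f v - g v) < e"
    by blast
qed

text \<open>Basis vectors in the domain do the work of density: pairing with
  \<open>basis_vec v\<close> recovers the coordinate \<open>h v\<close>, so the vector behind the
  \<open>THE\<close> is unique and may be replaced by its defining property.\<close>

lemma adjoint_op_eq_Some_iff:
  assumes "\<And>u. u \<in> V \<Longrightarrow> basis_vec u \<in> dom T"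
  shows "adjoint_op V T g = Some h \<longleftrightarrow>
    g \<in> l2 V \<and> h \<in> l2 V \<and> (\<forall>f\<in>dom T. l2_inner V (the (T f)) g = l2_inner V f h)"
    (is "_ \<longleftrightarrow> _ \<and> ?Q h")
proof -
  have unique: "h = h'" if "?Q h" "?Q h'" for h h'
  proof
    fix v
    show "h v = h' v"
    proof (cases "v \<in> V")
      case True
      then have "l2_inner V (basis_vec v) h = l2_inner V (basis_vec v) h'"
        using that assms[OF True] by (metis (no_types, lifting))
      then show ?thesis
        using True by (simp add: l2_inner_basis_left)
    next
      case False
      then show ?thesis
        using that l2_zero_outside by metis
    qed
  qed
  show ?thesis
  proof (cases "g \<in> l2 V \<and> (\<exists>h. ?Q h)")
    case True
    then obtain h0 where h0: "?Q h0" by blast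
    then have "(THE h. ?Q h) = h0"
      using unique by (intro the_equality) assumption+
    moreover have "adjoint_op V T g = Some (THE h. ?Q h)"
      unfolding adjoint_op_def Bex_def by (rule if_P) (use True in simp)
    ultimately have "adjoint_op V T g = Some h0" by simp
    then show ?thesis
      using True h0 unique by (metis option.inject)
  next
    case False
    then have "adjoint_op V T g = None"
      unfolding adjoint_op_def Bex_def by (intro if_not_P) simp
    with False show ?thesis by auto
  qed
qed

lemma selfadjoint_symmetric:
  assumes "selfadjoint V T" "\<And>u. u \<in> V \<Longrightarrow> basis_vec u \<in> dom T" "f \<in> dom T" "g \<in> dom T"
  shows "l2_inner V (the (T f)) g = l2_inner V f (the (T g))"
proof -
  have "adjoint_op V T g = Some (the (T g))"
    using assms(1,4) by (auto simp: selfadjoint_def)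
  then show ?thesis
    using assms(3) adjoint_op_eq_Some_iff[OF assms(2)] by blast
qed

lemma mult_op_real_symmetric:
  "l2_inner V (\<lambda>v. of_real (r v) * f v) g = l2_inner V f (\<lambda>v. of_real (r v) * g v)"
  by (simp add: l2_inner_def mult_ac)

text \<open>Testing the adjoint relation on basis vectors forces \<open>h v = r v * g v\<close> at
  every coordinate, and \<open>h\<close> being in \<open>l2 V\<close> then says that
  \<open>g\<close> is in the maximal domain. The converse is symmetry.\<close>

lemma selfadjoint_mult_op: "selfadjoint V (mult_op V (\<lambda>v. of_real (r v)))"
proof -
  let ?T = "mult_op V (\<lambda>v. complex_of_real (r v))"
  have "adjoint_op V ?T g = Some h \<longleftrightarrow> ?T g = Some h" for g h
  proof
    assume "adjoint_op V ?T g = Some h"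
    then have gh: "g \<in> l2 V" "h \<in> l2 V"
      and eq: "\<And>f. f \<in> dom ?T \<Longrightarrow> l2_inner V (the (?T f)) g = l2_inner V f h"
      by (simp_all add: adjoint_op_eq_Some_iff basis_vec_dom_mult_op)
    have "h v = of_real (r v) * g v" for v
    proof (cases "v \<in> V")
      case True
      with eq[OF basis_vec_dom_mult_op[OF True]] show ?thesis
        by (simp add: mult_op_eq_Some basis_vec_dom_mult_op mult_op_real_symmetric
            l2_inner_basis_left flip: complex_cnj_mult)
    qed (use gh in \<open>simp add: l2_zero_outside\<close>)
    then have "h = (\<lambda>v. of_real (r v) * g v)" ..
    with gh show "?T g = Some h"
      by (simp add: mult_op_def)
  next
    assume *: "?T g = Some h"
    then have "g \<in> l2 V" "h \<in> l2 V" "h = (\<lambda>v. of_real (r v) * g v)"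
      by (auto simp: mult_op_def split: if_splits)
    then show "adjoint_op V ?T g = Some h"
      by (simp add: adjoint_op_eq_Some_iff basis_vec_dom_mult_op mult_op_eq_Some
          mult_op_real_symmetric)
  qed
  then have "adjoint_op V ?T g = ?T g" for g
    by (cases "adjoint_op V ?T g"; cases "?T g") (simp_all, metis option.distinct(1))
  then have "adjoint_op V ?T = ?T" ..
  then show ?thesis
    by (simp add: selfadjoint_def linear_mult_op densely_defined_mult_op)
qed

text \<open>Provides existence and uniqueness of \<open>N\<close>. Symmetry against basis vectors
  shows that \<open>N\<close> is a restriction of the multiplication operator. Conversely, on the
  domain of the latter, multiplication by \<open>\<theta>\<close> satisfies the adjoint relation of
  \<open>N\<close>, and the adjoint of \<open>N\<close> is \<open>N\<close>.\<close>

lemma selfadjoint_diagonal_iff: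
  "selfadjoint_diagonal V \<theta> N \<longleftrightarrow> N = mult_op V (\<lambda>v. of_real (\<theta> v))"
proof
  let ?M = "mult_op V (\<lambda>v. complex_of_real (\<theta> v))"
  assume N: "selfadjoint_diagonal V \<theta> N"
  then have sa: "selfadjoint V N" and basis: "\<And>u. u \<in> V \<Longrightarrow> basis_vec u \<in> dom N"
    by (auto simp: selfadjoint_diagonal_def)
  have lin: "linear_operator V N"
    using sa by (simp add: selfadjoint_def)
  have eq: "g \<in> dom ?M \<and> N g = ?M g" if g: "g \<in> dom N" for g
  proof -
    have l2: "g \<in> l2 V" "the (N g) \<in> l2 V"
      using g lin by (auto simp: linear_operator_def ran_def)
    have "the (N g) v = of_real (\<theta> v) * g v" for v
    proof (cases "v \<in> V")
      case True
      have "the (N g) v = l2_inner V g (the (N (basis_vec v)))"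
        using True g selfadjoint_symmetric[OF sa basis g basis]
        by (simp add: l2_inner_basis_right)
      also have "\<dots> = of_real (\<theta> v) * g v"
        using N True by (simp add: selfadjoint_diagonal_def l2_inner_scale_right l2_inner_basis_right)
      finally show ?thesis .
    qed (use l2 in \<open>simp add: l2_zero_outside\<close>)
    then have "the (N g) = (\<lambda>v. of_real (\<theta> v) * g v)" ..
    with l2 g show ?thesis
      by (auto simp: dom_mult_op mult_op_def)
  qed
  have "g \<in> dom N" if g: "g \<in> dom ?M" for g
  proof -
    have "adjoint_op V N g = Some (\<lambda>v. of_real (\<theta> v) * g v)"
    proof (subst adjoint_op_eq_Some_iff[OF basis], assumption, intro conjI ballI)
      fix f assume "f \<in> dom N"
      then have "the (N f) = (\<lambda>v. of_real (\<theta> v) * f v)"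
        using eq[of f] by (simp add: mult_op_eq_Some)
      then show "l2_inner V (the (N f)) g = l2_inner V f (\<lambda>v. of_real (\<theta> v) * g v)"
        by (simp only: mult_op_real_symmetric)
    qed (use g in \<open>simp_all add: dom_mult_op\<close>)
    then show ?thesis
      using sa by (auto simp: selfadjoint_def)
  qed
  then have "N g = ?M g" for g
    using eq[of g] by (cases "g \<in> dom N") (blast, metis domIff)
  then show "N = ?M" ..
next
  assume "N = mult_op V (\<lambda>v. of_real (\<theta> v))"
  then show "selfadjoint_diagonal V \<theta> N"
    by (auto simp: selfadjoint_diagonal_def selfadjoint_mult_op mult_op_eq_Some
        basis_vec_dom_mult_op)
      (auto simp: basis_vec_def indicator_def)
qed

section \<open>Spectral measures\<close>

locale spectral =
  fixes V :: "'v set" and P :: "real set \<Rightarrow> 'v operator"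
  assumes spectral_measure: "spectral_measure V P"
begin

abbreviation pr :: "real set \<Rightarrow> ('v \<Rightarrow> complex) \<Rightarrow> 'v \<Rightarrow> complex" where
  "pr B f \<equiv> the (P B f)"

lemma orth_projection: "B \<in> sets borel \<Longrightarrow> orth_projection V (P B)"
  using spectral_measure by (simp add: spectral_measure_def)

lemma P_eq_Some:
  assumes "B \<in> sets borel" "f \<in> l2 V"
  shows "P B f = Some (pr B f)"
proof -
  have "f \<in> dom (P B)"
    using orth_projection[OF assms(1)] assms(2) by (simp add: orth_projection_def)
  then show ?thesis by auto
qed

lemma linear_P: "B \<in> sets borel \<Longrightarrow> linear_operator V (P B)"
  using orth_projection[of B] by (simp add: orth_projection_def selfadjoint_def)

lemma pr_l2: "B \<in> sets borel \<Longrightarrow> f \<in> l2 V \<Longrightarrow> pr B f \<in> l2 V"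
  using linear_P[of B] P_eq_Some[of B f] unfolding linear_operator_def by (blast intro: ranI)

lemma pr_add:
  assumes "B \<in> sets borel" "f \<in> l2 V" "g \<in> l2 V"
  shows "pr B (\<lambda>v. f v + g v) = (\<lambda>v. pr B f v + pr B g v)"
proof -
  have "f \<in> dom (P B)" "g \<in> dom (P B)"
    using assms P_eq_Some by blast+
  then have "P B (\<lambda>v. f v + g v) = Some (\<lambda>v. pr B f v + pr B g v)"
    using linear_P[OF assms(1)] unfolding linear_operator_def by blast
  then show ?thesis by simp
qed

lemma pr_idem:
  assumes "B \<in> sets borel" "f \<in> l2 V"
  shows "pr B (pr B f) = pr B f"
proof -
  have "(P B \<circ>\<^sub>m P B) f = P B f"
    using orth_projection[OF assms(1)] by (simp add: orth_projection_def)
  then show ?thesis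
    using P_eq_Some[OF assms] by (simp add: map_comp_def split: option.splits)
qed

lemma pr_symmetric:
  assumes "B \<in> sets borel" "f \<in> l2 V" "g \<in> l2 V"
  shows "l2_inner V (pr B f) g = l2_inner V f (pr B g)"
  using orth_projection[OF assms(1)] assms
  by (intro selfadjoint_symmetric) (auto simp: orth_projection_def basis_vec_l2)

lemma pr_inner_self:
  assumes "B \<in> sets borel" "f \<in> l2 V"
  shows "l2_inner V (pr B f) f = of_real ((l2_norm V (pr B f))\<^sup>2)"
  using pr_symmetric[OF assms(1) pr_l2[OF assms] assms(2)]
  by (simp add: pr_idem pr_l2 assms l2_inner_self)

text \<open>Cauchy-Schwarz turns norm convergence of the partial sums into convergence of inner
  products, the form in which countable additivity is used below.\<close>

lemma pr_inner_sums:
  assumes "range B \<subseteq> sets borel" "disjoint_family B" "f \<in> l2 V" "g \<in> l2 V"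
  shows "(\<lambda>k. l2_inner V (pr (B k) f) g) sums l2_inner V (pr (\<Union>k. B k) f) g"
proof -
  let ?d = "\<lambda>n v. (\<Sum>k<n. pr (B k) f v) - pr (\<Union>k. B k) f v"
  have B: "B k \<in> sets borel" for k
    using assms(1) by auto
  note l2 = pr_l2[OF B assms(3)] pr_l2[OF sets.countable_UN[OF assms(1)] assms(3)]
  have "(\<lambda>n. l2_norm V (?d n)) \<longlonglongrightarrow> 0"
    using spectral_measure assms by (simp add: spectral_measure_def)
  from tendsto_mult_left_zero[OF this] have lim: "(\<lambda>n. l2_norm V (?d n) * l2_norm V g) \<longlonglongrightarrow> 0" .
  have "l2_inner V (?d n) g =
      (\<Sum>k<n. l2_inner V (pr (B k) f) g) - l2_inner V (pr (\<Union>k. B k) f) g" for n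
    by (simp add: l2_inner_diff_left l2_sum l2_inner_sum_left l2 assms)
  moreover have "?d n \<in> l2 V" for n
    by (intro l2_diff l2_sum l2)
  ultimately have "norm ((\<Sum>k<n. l2_inner V (pr (B k) f) g) - l2_inner V (pr (\<Union>k. B k) f) g)
      \<le> l2_norm V (?d n) * l2_norm V g" for n
    using l2_cauchy_schwarz[OF _ assms(4), of "?d n"] by simp
  then have "(\<lambda>n. (\<Sum>k<n. l2_inner V (pr (B k) f) g) - l2_inner V (pr (\<Union>k. B k) f) g) \<longlonglongrightarrow> 0"
    by (intro Lim_null_comparison[OF always_eventually lim] allI)
  then show ?thesis
    unfolding sums_def by (simp add: LIM_zero_iff)
qed

text \<open>The constant sequence of empty sets is disjoint, and a series with constant terms
  converges only if the terms vanish.\<close>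

lemma pr_empty_inner:
  assumes "f \<in> l2 V" "g \<in> l2 V"
  shows "l2_inner V (pr {} f) g = 0"
  using sums_summable[OF pr_inner_sums[of "\<lambda>_. {}", OF _ _ assms]]
    summable_const_iff[of "l2_inner V (pr {} f) g"]
  by (simp add: disjoint_family_on_def)

lemma pr_disjoint_union:
  assumes "A \<in> sets borel" "B \<in> sets borel" "A \<inter> B = {}" "f \<in> l2 V"
  shows "pr (A \<union> B) f v = pr A f v + pr B f v"
proof (cases "v \<in> V")
  case True
  have "(\<lambda>k. l2_inner V (pr (binaryset A B k) f) (basis_vec v)) sums
      l2_inner V (pr (A \<union> B) f) (basis_vec v)"
    unfolding UN_binaryset_eq[of A B, symmetric]
    by (rule pr_inner_sums)
      (use assms True in \<open>auto simp: range_binaryset_eq basis_vec_l2 disjoint_family_on_def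
        binaryset_def\<close>)
  moreover have "(\<lambda>k. l2_inner V (pr (binaryset A B k) f) (basis_vec v)) sums
      (l2_inner V (pr A f) (basis_vec v) + l2_inner V (pr B f) (basis_vec v))"
    using binaryset_sums[of "\<lambda>B. l2_inner V (pr B f) (basis_vec v)"] assms True
    by (simp add: pr_empty_inner basis_vec_l2)
  ultimately show ?thesis
    using sums_unique2[of "\<lambda>k. l2_inner V (pr (binaryset A B k) f) (basis_vec v)"] True
    by (simp add: l2_inner_basis_right)
next
  case False
  then show ?thesis
    using assms by (simp add: l2_zero_outside[OF pr_l2])
qed

lemma pr_compl:
  assumes "B \<in> sets borel" "f \<in> l2 V"
  shows "pr B f v + pr (- B) f v = f v"
proof -
  have "P UNIV f = Some f"
    using spectral_measure assms by (simp add: spectral_measure_def)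
  then show ?thesis
    using pr_disjoint_union[of B "- B" f v] assms by simp
qed

text \<open>Pairing the decomposition of \<open>pr B f\<close> over \<open>A\<close> and
  \<open>B - A\<close> with \<open>f\<close> writes zero as a sum of two squared norms.\<close>

lemma pr_subset_zero:
  assumes "A \<in> sets borel" "B \<in> sets borel" "A \<subseteq> B" "f \<in> l2 V" "pr B f = (\<lambda>_. 0)"
  shows "pr A f = (\<lambda>_. 0)"
proof -
  have "pr B f = (\<lambda>v. pr A f v + pr (B - A) f v)"
    using pr_disjoint_union[of A "B - A" f] assms by (auto simp: Un_absorb1)
  then have "l2_inner V (pr B f) f = l2_inner V (pr A f) f + l2_inner V (pr (B - A) f) f"
    using assms by (simp only: l2_inner_add_left pr_l2 sets.Diff)
  then have "0 = complex_of_real ((l2_norm V (pr A f))\<^sup>2 + (l2_norm V (pr (B - A) f))\<^sup>2)"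
    using assms by (simp add: pr_inner_self) (simp add: l2_inner_def)
  then have "(l2_norm V (pr A f))\<^sup>2 + (l2_norm V (pr (B - A) f))\<^sup>2 = 0"
    by (metis of_real_eq_0_iff)
  then have "l2_norm V (pr A f) = 0"
    by (simp add: sum_power2_eq_zero_iff)
  then show ?thesis
    by (rule l2_norm_eq_0_D[OF pr_l2[OF assms(1,4)]])
qed

lemma pr_compl_pr:
  assumes "B \<in> sets borel" "f \<in> l2 V"
  shows "pr (- B) (pr B f) = (\<lambda>_. 0)"
proof
  fix v
  show "pr (- B) (pr B f) v = 0"
    using pr_compl[OF assms(1) pr_l2[OF assms], of v] assms by (simp add: pr_idem)
qed

text \<open>Multiplicativity follows from additivity and idempotence: \<open>pr (A - B)\<close>
  kills \<open>pr B f\<close> because \<open>A - B\<close> lies in \<open>- B\<close>, and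
  \<open>pr (A \<inter> B)\<close> kills \<open>pr (- B) f\<close> because
  \<open>A \<inter> B\<close> lies in \<open>B\<close>.\<close>

lemma pr_pr:
  assumes A: "A \<in> sets borel" and B: "B \<in> sets borel" and f: "f \<in> l2 V"
  shows "pr A (pr B f) = pr (A \<inter> B) f"
proof -
  let ?g = "pr B f" and ?h = "pr (- B) f"
  have AB: "A \<inter> B \<in> sets borel" "A - B \<in> sets borel" "- B \<in> sets borel"
    using A B by auto
  note l2 = pr_l2[OF B f] pr_l2[OF AB(3) f]
  have zero: "pr (A - B) ?g = (\<lambda>_. 0)" "pr (A \<inter> B) ?h = (\<lambda>_. 0)"
    using pr_subset_zero[OF AB(2,3) _ l2(1) pr_compl_pr[OF B f]]
      pr_subset_zero[OF AB(1) B _ l2(2)] pr_compl_pr[OF AB(3) f] by auto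
  have "pr A ?g v = pr (A \<inter> B) ?g v" for v
    using pr_disjoint_union[OF AB(1,2) _ l2(1), of v] zero(1) by (simp add: Int_Diff_Un Int_Diff_disjoint)
  moreover have "pr (A \<inter> B) f v = pr (A \<inter> B) ?g v" for v
    using pr_add[OF AB(1) l2] zero(2) by (simp add: pr_compl[OF B f])
  ultimately show ?thesis by auto
qed

section \<open>Scalar measures of a spectral measure\<close>

lemma sets_scalar_measure [simp, measurable_cong]: "sets (scalar_measure V P f) = sets borel"
  unfolding scalar_measure_def using sets.sigma_sets_eq[of "borel :: real measure"]
  by simp

lemma space_scalar_measure [simp]: "space (scalar_measure V P f) = UNIV"
  using sets_eq_imp_space_eq[OF sets_scalar_measure] by simp

lemma emeasure_scalar_measure:
  assumes "B \<in> sets borel" "f \<in> l2 V"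
  shows "emeasure (scalar_measure V P f) B = ennreal ((l2_norm V (pr B f))\<^sup>2)"
proof -
  let ?\<mu> = "\<lambda>B. ennreal (Re (l2_inner V (pr B f) f))"
  have nonneg: "0 \<le> Re (l2_inner V (pr B f) f)" if "B \<in> sets borel" for B
    using that assms by (simp add: pr_inner_self)
  \<comment> \<open>\<open>measure_of\<close> returns the prescribed values only for a positive,
    countably additive set function, so both properties have to be established first.\<close>
  have "countably_additive (sets borel) ?\<mu>"
    unfolding countably_additive_def
  proof (intro allI impI)
    fix B :: "nat \<Rightarrow> real set"
    assume B: "range B \<subseteq> sets borel" "disjoint_family B"
    then have "(\<lambda>k. Re (l2_inner V (pr (B k) f) f)) sums Re (l2_inner V (pr (\<Union>k. B k) f) f)"
      using assms by (intro sums_Re pr_inner_sums)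
    then show "(\<Sum>k. ?\<mu> (B k)) = ?\<mu> (\<Union>k. B k)"
      using B by (intro suminf_ennreal_eq nonneg) auto
  qed
  moreover have "sigma_algebra UNIV (sets (borel :: real measure))"
    using sets.sigma_algebra_axioms[of "borel :: real measure"] by simp
  moreover have "positive (sets borel) ?\<mu>"
    using assms by (simp add: positive_def pr_empty_inner)
  ultimately have "emeasure (scalar_measure V P f) B = ?\<mu> B"
    unfolding scalar_measure_def using assms(1) by (intro emeasure_measure_of_sigma)
  with assms show ?thesis
    by (simp add: pr_inner_self)
qed

lemma finite_scalar_measure: "f \<in> l2 V \<Longrightarrow> finite_measure (scalar_measure V P f)"
  by (intro finite_measureI) (simp add: emeasure_scalar_measure)

lemma measure_scalar_measure:
  "B \<in> sets borel \<Longrightarrow> f \<in> l2 V \<Longrightarrow> measure (scalar_measure V P f) B = (l2_norm V (pr B f))\<^sup>2"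
  by (simp add: measure_def emeasure_scalar_measure)

text \<open>By multiplicativity, passing from \<open>f\<close> to \<open>pr B f\<close> restricts
  the scalar measure to \<open>B\<close>. Integrals belonging to a projected vector thus become
  integrals over \<open>B\<close>.\<close>

lemma scalar_measure_pr:
  assumes "B \<in> sets borel" "f \<in> l2 V"
  shows "scalar_measure V P (pr B f) = density (scalar_measure V P f) (\<lambda>x. ennreal (indicator B x))"
proof (rule measure_eqI)
  fix C assume "C \<in> sets (scalar_measure V P (pr B f))"
  then have C: "C \<in> sets borel" by simp
  then have "emeasure (scalar_measure V P (pr B f)) C = emeasure (scalar_measure V P f) (C \<inter> B)"
    using assms by (simp add: emeasure_scalar_measure pr_l2 pr_pr)
  also have "\<dots> = (\<integral>\<^sup>+x. indicator (C \<inter> B) x \<partial>scalar_measure V P f)"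
    using C assms by simp
  also have "\<dots> = (\<integral>\<^sup>+x. ennreal (indicator B x) * indicator C x \<partial>scalar_measure V P f)"
    by (intro nn_integral_cong) (auto simp: indicator_def)
  finally show "emeasure (scalar_measure V P (pr B f)) C =
      emeasure (density (scalar_measure V P f) (\<lambda>x. ennreal (indicator B x))) C"
    using C assms(1) by (simp add: emeasure_density)
qed simp

end

section \<open>Spectral measures representing a diagonal operator\<close>

locale diagonal_spectral = spectral V P for V :: "'v set" and P +
  fixes \<theta> :: "'v \<Rightarrow> real"
  assumes integral_id: "is_spectral_integral V P of_real (mult_op V (\<lambda>v. of_real (\<theta> v)))"
begin

text \<open>Splitting an eigenvector \<open>e = g + h\<close> with \<open>g = P(B) e\<close>, \<open>h = P(- B) e\<close>, additivity of the
  spectral integral over \<open>B\<close> and \<open>- B\<close> forces the cross terms \<open>\<langle>N g, h\<rangle>\<close> to have real part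
  \<open>0\<close>, so that \<open>\<theta> u * \<mu>(B) = Re \<langle>N e, g\<rangle> = Re \<langle>N g, g\<rangle>\<close>, the integral of \<open>x\<close> over \<open>B\<close>.\<close>

lemma eigenvector_set_integral:
  assumes u: "u \<in> V" and B: "B \<in> sets borel"
  defines "\<mu> \<equiv> scalar_measure V P (basis_vec u)"
  shows "integrable \<mu> (\<lambda>x. x)"
    and "(\<integral>x. indicator B x * x \<partial>\<mu>) = \<theta> u * measure \<mu> B"
proof -
  let ?e = "basis_vec u :: 'v \<Rightarrow> complex"
  let ?N = "mult_op V (\<lambda>v. complex_of_real (\<theta> v))"
  let ?n = "\<lambda>f v. complex_of_real (\<theta> v) * f v"
  let ?g = "pr B ?e" and ?h = "pr (- B) ?e"
  have e: "?e \<in> l2 V"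
    using u by (rule basis_vec_l2)
  have B': "- B \<in> sets borel"
    using B by auto
  interpret \<mu>: finite_measure \<mu>
    unfolding \<mu>_def using e by (rule finite_scalar_measure)
  have sets_\<mu> [simp, measurable_cong]: "sets \<mu> = sets borel"
    by (simp add: \<mu>_def)
  have dom: "f \<in> dom ?N \<longleftrightarrow> f \<in> l2 V \<and> integrable (scalar_measure V P f) (\<lambda>x. x\<^sup>2)" for f
    using integral_id by (simp add: is_spectral_integral_def)
  have form: "Re (l2_inner V (?n f) f) = (\<integral>x. x \<partial>scalar_measure V P f)" if "f \<in> dom ?N" for f
    using integral_id that by (simp add: is_spectral_integral_def mult_op_eq_Some)
  have "?e \<in> dom ?N"
    using u by (rule basis_vec_dom_mult_op)
  then have square: "integrable \<mu> (\<lambda>x. x\<^sup>2)"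
    by (simp add: dom \<mu>_def)
  show int: "integrable \<mu> (\<lambda>x. x)"
  proof (rule Bochner_Integration.integrable_bound)
    show "integrable \<mu> (\<lambda>x. 1 + x\<^sup>2)"
      using square by simp
    have "norm x \<le> norm (1 + x\<^sup>2)" for x :: real
      using zero_le_power2[of "\<bar>x\<bar> - 1"] by (simp add: power2_eq_square algebra_simps)
    then show "AE x in \<mu>. norm x \<le> norm (1 + x\<^sup>2)" by simp
  qed simp
  have pr_dom: "pr C ?e \<in> dom ?N"
    and pr_form: "Re (l2_inner V (?n (pr C ?e)) (pr C ?e)) = (\<integral>x. indicator C x * x \<partial>\<mu>)"
    if C: "C \<in> sets borel" for C
  proof -
    \<comment> \<open>The domain of \<open>?N\<close> is described through \<open>P\<close>, so
      square integrability over \<open>C\<close> already places \<open>pr C ?e\<close> in it. That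
      \<open>P\<close> commutes with \<open>?N\<close> is not known at this point.\<close>
    have "integrable \<mu> (\<lambda>x. indicator C x *\<^sub>R x\<^sup>2)"
      by (rule integrable_mult_indicator) (use square C in auto)
    then show "pr C ?e \<in> dom ?N"
      using C e by (simp add: dom pr_l2 scalar_measure_pr integrable_density flip: \<mu>_def)
    from form[OF this]
    show "Re (l2_inner V (?n (pr C ?e)) (pr C ?e)) = (\<integral>x. indicator C x * x \<partial>\<mu>)"
      using C e by (simp add: scalar_measure_pr integral_density flip: \<mu>_def)
  qed
  note l2 = pr_l2[OF B e] pr_l2[OF B' e]
  have nl2: "?n ?g \<in> l2 V" "?n ?h \<in> l2 V"
    using pr_dom[OF B] pr_dom[OF B'] by (simp_all add: dom_mult_op)
  have split: "?e = (\<lambda>v. ?g v + ?h v)"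
    using pr_compl[OF B e] by auto
  have nsplit: "?n ?e = (\<lambda>v. ?n ?g v + ?n ?h v)"
    by (subst (1) split) (simp add: distrib_left)
  have ne: "?n ?e = (\<lambda>v. of_real (\<theta> u) * ?e v)"
    by (auto simp: basis_vec_def indicator_def)
  have "Re (l2_inner V (?n ?e) ?e) =
      Re (l2_inner V (?n ?g) ?g) + Re (l2_inner V (?n ?h) ?h)
      + Re (l2_inner V (?n ?g) ?h) + Re (l2_inner V (?n ?h) ?g)"
    unfolding nsplit by (subst split) (simp add: l2_inner_add_left l2_inner_add_right l2 nl2 l2_add)
  moreover have "Re (l2_inner V (?n ?e) ?e) = (\<integral>x. x \<partial>\<mu>)"
    using form[OF \<open>?e \<in> dom ?N\<close>] by (simp add: \<mu>_def)
  moreover have "\<dots> = (\<integral>x. indicator B x * x + indicator (- B) x * x \<partial>\<mu>)"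
    by (intro Bochner_Integration.integral_cong) (auto simp: indicator_def)
  moreover have "\<dots> = (\<integral>x. indicator B x * x \<partial>\<mu>) + (\<integral>x. indicator (- B) x * x \<partial>\<mu>)"
    using integrable_mult_indicator[OF _ int] B B'
    by (intro Bochner_Integration.integral_add) auto
  \<comment> \<open>By symmetry of \<open>?N\<close> the two cross terms are complex conjugates. The
    two diagonal terms already add up to the whole integral, so the common real part of the cross
    terms is zero.\<close>
  moreover have "Re (l2_inner V (?n ?g) ?h) = Re (l2_inner V (?n ?h) ?g)"
    unfolding mult_op_real_symmetric[of V \<theta> ?g ?h] by (subst l2_inner_commute) simp
  ultimately have cross: "Re (l2_inner V (?n ?h) ?g) = 0"
    using pr_form[OF B] pr_form[OF B'] by simp
  have "\<theta> u * measure \<mu> B = Re (l2_inner V (?n ?e) ?g)"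
    using pr_inner_self[OF B e] pr_symmetric[OF B e e]
    by (simp add: ne l2_inner_scale_left \<mu>_def measure_scalar_measure B e)
  also have "\<dots> = Re (l2_inner V (?n ?g) ?g)"
    using cross unfolding nsplit by (simp add: l2_inner_add_left l2 nl2)
  finally show "(\<integral>x. indicator B x * x \<partial>\<mu>) = \<theta> u * measure \<mu> B"
    using pr_form[OF B] by simp
qed

text \<open>By the set integrals above, \<open>x - \<theta> u\<close> integrates to zero over every
  Borel set. On each of the open half-lines above and below \<open>\<theta> u\<close> it has
  constant sign, so both half-lines are null sets.\<close>

lemma eigenvector_scalar_measure_AE:
  assumes u: "u \<in> V"
  shows "AE x in scalar_measure V P (basis_vec u). x = \<theta> u"
proof -
  define \<mu> where "\<mu> = scalar_measure V P (basis_vec u)"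
  interpret \<mu>: finite_measure \<mu>
    unfolding \<mu>_def using u by (intro finite_scalar_measure basis_vec_l2)
  have sets_\<mu> [simp, measurable_cong]: "sets \<mu> = sets borel"
    by (simp add: \<mu>_def)
  have int: "integrable \<mu> (\<lambda>x. indicator B x * (x - \<theta> u))"
    and zero: "(\<integral>x. indicator B x * (x - \<theta> u) \<partial>\<mu>) = 0" if B: "B \<in> sets borel" for B
  proof -
    note eig = eigenvector_set_integral[OF u B, folded \<mu>_def]
    have ints: "integrable \<mu> (\<lambda>x. indicator B x * x)" "integrable \<mu> (\<lambda>x. indicator B x * \<theta> u)"
      using integrable_mult_indicator[OF _ eig(1), of B]
        integrable_mult_indicator[of B \<mu> "\<lambda>_. \<theta> u"] B by simp_all
    then show "integrable \<mu> (\<lambda>x. indicator B x * (x - \<theta> u))"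
      by (simp add: right_diff_distrib)
    show "(\<integral>x. indicator B x * (x - \<theta> u) \<partial>\<mu>) = 0"
      using ints eig(2) B by (simp add: right_diff_distrib mult.commute)
  qed
  have "AE x in \<mu>. indicator {\<theta> u<..} x * (x - \<theta> u) = 0"
    using integral_nonneg_eq_0_iff_AE[OF int[of "{\<theta> u<..}"]] zero[of "{\<theta> u<..}"]
    by (auto simp: indicator_def)
  moreover have "AE x in \<mu>. - (indicator {..<\<theta> u} x * (x - \<theta> u)) = 0"
    using integral_nonneg_eq_0_iff_AE[OF integrable_minus[OF int[of "{..<\<theta> u}"]]]
      zero[of "{..<\<theta> u}"]
    by (auto simp: indicator_def)
  ultimately show ?thesis
    unfolding \<mu>_def[symmetric] by eventually_elim (auto simp: indicator_def split: if_splits)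
qed

text \<open>A Borel set missing \<open>\<theta> u\<close> is null for the scalar measure, and this
  measure is the squared norm of the projected vector. A set containing \<open>\<theta> u\<close> is
  handled through its complement.\<close>

lemma pr_basis_vec:
  assumes u: "u \<in> V" and C: "C \<in> sets borel"
  shows "pr C (basis_vec u) = (\<lambda>v. indicator C (\<theta> u) * basis_vec u v)"
proof -
  let ?\<mu> = "scalar_measure V P (basis_vec u)"
  have e: "basis_vec u \<in> l2 V"
    using u by (rule basis_vec_l2)
  have zero: "pr D (basis_vec u) = (\<lambda>_. 0)" if D: "D \<in> sets borel" "\<theta> u \<notin> D" for D
  proof -
    have "AE x in ?\<mu>. x \<notin> D"
      using eigenvector_scalar_measure_AE[OF u] by eventually_elim (use D in auto)
    then have "emeasure ?\<mu> D = 0"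
      by (subst (asm) AE_iff_measurable[of D]) (use D in auto)
    then have "l2_norm V (pr D (basis_vec u)) = 0"
      using D e by (simp add: emeasure_scalar_measure)
    then show ?thesis
      by (rule l2_norm_eq_0_D[OF pr_l2[OF D(1) e]])
  qed
  show ?thesis
  proof (cases "\<theta> u \<in> C")
    case True
    then have "pr C (basis_vec u) v = basis_vec u v" for v
      using zero[of "- C"] pr_compl[OF C e, of v] C by simp
    with True show ?thesis by auto
  qed (use zero C in simp)
qed

text \<open>By symmetry, the coordinate of \<open>pr B f\<close> at \<open>v\<close> is the inner
  product of \<open>f\<close> with \<open>pr B (basis_vec v)\<close>, so the values on basis vectors
  determine the projection without any approximation of \<open>f\<close>.\<close>

lemma P_eq_indicator:
  assumes f: "f \<in> l2 V" and B: "B \<in> sets borel"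
  shows "P B f = Some (\<lambda>v. indicator B (\<theta> v) * f v)"
proof -
  have "pr B f v = indicator B (\<theta> v) * f v" for v
  proof (cases "v \<in> V")
    case True
    then have "pr B f v = l2_inner V f (pr B (basis_vec v))"
      using pr_symmetric[OF B f basis_vec_l2[OF True]] by (simp add: l2_inner_basis_right)
    also have "\<dots> = indicator B (\<theta> v) * f v"
      using True B by (simp add: pr_basis_vec l2_inner_scale_right l2_inner_basis_right indicator_def)
    finally show ?thesis .
  qed (use assms in \<open>simp add: l2_zero_outside[OF pr_l2] l2_zero_outside[OF f]\<close>)
  then have "pr B f = (\<lambda>v. indicator B (\<theta> v) * f v)" ..
  then show ?thesis
    using P_eq_Some[OF B f] by simp
qed

end

section \<open>Integrals against spectral measures of indicator form\<close>

lemma integrable_count_space_iff: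
  fixes f :: "'a \<Rightarrow> 'b :: {banach, second_countable_topology}"
  shows "integrable (count_space A) f \<longleftrightarrow> (\<lambda>x. norm (f x)) summable_on A"
  using abs_summable_equivalent[of f A] by (simp add: Infinite_Set_Sum.abs_summable_on_def)

lemma integral_count_space_eq_infsum:
  fixes f :: "'a \<Rightarrow> 'b :: {banach, second_countable_topology}"
  assumes "(\<lambda>x. norm (f x)) summable_on A"
  shows "(\<integral>x. f x \<partial>count_space A) = infsum f A"
  using infsetsum_infsum[of f A] abs_summable_equivalent[of f A] assms by (simp add: infsetsum_def)

context spectral
begin

text \<open>An arbitrary \<open>P\<close> of indicator form is fixed so that the results serve
  twice: for the canonical spectral measure, giving existence in the Borel calculus, and for any
  \<open>P\<close> representing \<open>N\<close>, giving uniqueness.\<close>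

context
  fixes \<theta> :: "'v \<Rightarrow> real"
  assumes P_indicator:
    "\<And>B f. B \<in> sets borel \<Longrightarrow> f \<in> l2 V \<Longrightarrow> P B f = Some (\<lambda>v. indicator B (\<theta> v) * f v)"
begin

text \<open>Turns integrals over the reals into sums over \<open>V\<close>. On a Borel set both
  measures are the sum of \<open>(cmod (f v))\<^sup>2\<close> over the \<open>v\<close> in
  \<open>V\<close> with \<open>\<theta> v\<close> in that set.\<close>

lemma scalar_measure_indicator:
  assumes f: "f \<in> l2 V"
  shows "scalar_measure V P f =
    distr (density (count_space V) (\<lambda>v. ennreal ((cmod (f v))\<^sup>2))) borel \<theta>"
proof (rule measure_eqI)
  fix B assume "B \<in> sets (scalar_measure V P f)"
  then have B: "B \<in> sets borel" by simp
  let ?q = "\<lambda>v. indicator B (\<theta> v) * (cmod (f v))\<^sup>2"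
  have "?q = (\<lambda>v. (cmod (indicator B (\<theta> v) * f v))\<^sup>2)"
    by (auto simp: indicator_def)
  moreover have "(\<lambda>v. indicator B (\<theta> v) * f v) \<in> l2 V"
    using pr_l2[OF B f] P_indicator[OF B f] by simp
  ultimately have summable: "(\<lambda>v. norm (?q v)) summable_on V"
    using l2_summable by fastforce
  have "emeasure (scalar_measure V P f) B = ennreal (infsum ?q V)"
    using B f \<open>?q = _\<close> by (simp add: emeasure_scalar_measure l2_norm_squared P_indicator)
  also have "\<dots> = ennreal (\<integral>v. ?q v \<partial>count_space V)"
    using integral_count_space_eq_infsum[OF summable] by simp
  also have "\<dots> = (\<integral>\<^sup>+v. ennreal (?q v) \<partial>count_space V)"
    using summable by (intro nn_integral_eq_integral[symmetric]) (simp_all add: integrable_count_space_iff)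
  also have "\<dots> = (\<integral>\<^sup>+v. ennreal ((cmod (f v))\<^sup>2) * indicator (\<theta> -` B) v \<partial>count_space V)"
    by (intro nn_integral_cong) (simp add: indicator_def)
  also have "\<dots> = (\<integral>\<^sup>+v. ennreal ((cmod (f v))\<^sup>2) * indicator (\<theta> -` B \<inter> V) v \<partial>count_space V)"
    by (intro nn_integral_cong) (simp add: indicator_def)
  finally show "emeasure (scalar_measure V P f) B =
      emeasure (distr (density (count_space V) (\<lambda>v. ennreal ((cmod (f v))\<^sup>2))) borel \<theta>) B"
    using B by (simp add: emeasure_distr emeasure_density)
qed simp

lemma spectral_integral_mult_op:
  assumes \<phi> [measurable]: "\<phi> \<in> borel_measurable borel"
  shows "is_spectral_integral V P \<phi> (mult_op V (\<lambda>v. \<phi> (\<theta> v)))"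
  unfolding is_spectral_integral_def
proof (intro conjI ballI linear_mult_op)
  let ?T = "mult_op V (\<lambda>v. \<phi> (\<theta> v))"
  have "integrable (scalar_measure V P f) (\<lambda>x. (cmod (\<phi> x))\<^sup>2) \<longleftrightarrow> (\<lambda>v. \<phi> (\<theta> v) * f v) \<in> l2 V"
    if f: "f \<in> l2 V" for f
  proof -
    have "integrable (scalar_measure V P f) (\<lambda>x. (cmod (\<phi> x))\<^sup>2) \<longleftrightarrow>
        (\<lambda>v. (cmod (\<phi> (\<theta> v) * f v))\<^sup>2) summable_on V"
      by (simp add: scalar_measure_indicator[OF f] integrable_distr_eq integrable_density
          integrable_count_space_iff norm_mult power_mult_distrib mult.commute)
    then show ?thesis
      using f by (simp add: l2_def)
  qed
  then show "dom ?T = {f \<in> l2 V. integrable (scalar_measure V P f) (\<lambda>x. (cmod (\<phi> x))\<^sup>2)}"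
    by (auto simp: dom_mult_op)
  fix f assume dom: "f \<in> dom ?T"
  then have f: "f \<in> l2 V" "(\<lambda>v. \<phi> (\<theta> v) * f v) \<in> l2 V"
    by (simp_all add: dom_mult_op)
  let ?q = "\<lambda>v. (cmod (f v))\<^sup>2 *\<^sub>R \<phi> (\<theta> v)"
  have q: "?q v = \<phi> (\<theta> v) * f v * cnj (f v)" for v
    by (simp add: scaleR_conv_of_real complex_norm_square mult_ac del: of_real_power)
  have "(\<lambda>v. norm (?q v)) summable_on V"
    using l2_inner_abs_summable[OF f(2,1)] unfolding q norm_mult complex_mod_cnj .
  then have "l2_inner V (\<lambda>v. \<phi> (\<theta> v) * f v) f = (\<integral>v. ?q v \<partial>count_space V)"
    using integral_count_space_eq_infsum[of ?q V] by (simp add: l2_inner_def q)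
  also have "\<dots> = (\<integral>x. \<phi> x \<partial>scalar_measure V P f)"
    by (simp add: scalar_measure_indicator[OF f(1)] integral_distr integral_density)
  finally show "l2_inner V (the (?T f)) f = (\<integral>x. \<phi> x \<partial>scalar_measure V P f)"
    using dom by (simp add: mult_op_eq_Some)
qed

end

end

text \<open>Countable additivity in norm is dominated convergence for sums over \<open>V\<close>:
  each \<open>\<theta> v\<close> lies in at most one \<open>B k\<close>, so the indicator of the
  tail union at \<open>\<theta> v\<close> is eventually zero, and
  \<open>(cmod (f v))\<^sup>2\<close> is a summable bound.\<close>

lemma spectral_measure_indicator:
  "spectral_measure V (\<lambda>B. mult_op V (\<lambda>v. of_real (indicator B (\<theta> v))))"
  (is "spectral_measure V ?P")
  unfolding spectral_measure_def
proof (intro conjI ballI allI impI)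
  have dom: "dom (?P B) = l2 V" for B
    by (rule dom_mult_op_bounded[of _ _ 1]) (simp add: indicator_def)
  have P: "?P B f = Some (\<lambda>v. of_real (indicator B (\<theta> v)) * f v)" if "f \<in> l2 V" for B f
    using that dom by (simp add: mult_op_eq_Some)
  have l2: "(\<lambda>v. of_real (indicator B (\<theta> v)) * f v) \<in> l2 V" if "f \<in> l2 V" for B f
    using that dom[of B] by (auto simp: dom_mult_op)
  show "?P UNIV f = Some f" if "f \<in> l2 V" for f
    using P[OF that, of UNIV] by simp
  show "orth_projection V (?P B)" for B
  proof -
    have "(?P B \<circ>\<^sub>m ?P B) f = ?P B f" for f
    proof (cases "f \<in> l2 V")
      case True
      have "(?P B \<circ>\<^sub>m ?P B) f = ?P B (\<lambda>v. of_real (indicator B (\<theta> v)) * f v)"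
        unfolding map_comp_def P[OF True] by simp
      also have "\<dots> = ?P B f"
        unfolding P[OF l2[OF True]] P[OF True] by (auto simp: indicator_def)
      finally show ?thesis .
    next
      case False
      then show ?thesis by (simp add: map_comp_def mult_op_def)
    qed
    then have "?P B \<circ>\<^sub>m ?P B = ?P B" ..
    then show ?thesis
      by (simp add: orth_projection_def dom selfadjoint_mult_op)
  qed
  fix B :: "nat \<Rightarrow> real set" and f
  assume B: "range B \<subseteq> sets borel" "disjoint_family B" and f: "f \<in> l2 V"
  have disj: "B i \<inter> B j = {}" if "i \<noteq> j" for i j
    using B(2) that by (simp add: disjoint_family_on_def)
  let ?q = "\<lambda>A v. (cmod (of_real (indicator A (\<theta> v)) * f v))\<^sup>2"
  let ?tail = "\<lambda>n. \<Union>k\<in>{n..}. B k"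
  have tail: "(\<Sum>k<n. the (?P (B k) f) v) - the (?P (\<Union>k. B k) f) v =
      - (of_real (indicator (?tail n) (\<theta> v)) * f v)" for n v
  proof -
    let ?r = "indicator (\<Union>k<n. B k) (\<theta> v) :: real"
    have "(\<Sum>k<n. indicator (B k) (\<theta> v)) = ?r"
      using B(2) by (intro indicator_UN_disjoint[symmetric]) (auto simp: disjoint_family_on_def)
    moreover have "indicator (\<Union>k. B k) (\<theta> v) = ?r + indicator (?tail n) (\<theta> v)"
    proof -
      have "x \<notin> B j" if "x \<in> B i" "i < n" "n \<le> j" for x i j
        using that disj[of i j] by auto
      then have "(\<Union>k<n. B k) \<inter> ?tail n = {}"
        unfolding disjoint_iff UN_iff lessThan_iff atLeast_iff by blast
      moreover have "(\<Union>k. B k) = (\<Union>k<n. B k) \<union> ?tail n"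
        unfolding UN_Un[symmetric] by (intro arg_cong[of _ _ Union] arg_cong[of _ _ "image B"]) auto
      ultimately show ?thesis
        by (simp only: indicator_disj_union)
    qed
    ultimately have "(\<Sum>k<n. indicator (B k) (\<theta> v)) - indicator (\<Union>k. B k) (\<theta> v) =
        - (indicator (?tail n) (\<theta> v) :: real)" by simp
    then have "complex_of_real ((\<Sum>k<n. indicator (B k) (\<theta> v)) - indicator (\<Union>k. B k) (\<theta> v)) * f v =
        of_real (- indicator (?tail n) (\<theta> v)) * f v" by simp
    then show ?thesis
      by (simp add: P f sum_distrib_right left_diff_distrib)
  qed
  have "(\<lambda>n. \<Sum>\<^sub>\<infinity>v\<in>V. ?q (?tail n) v) \<longlonglongrightarrow> 0"
  proof -
    have abs: "(\<lambda>v. norm (?q A v)) summable_on V" for A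
      using l2_summable[OF l2[OF f, of A]] by simp
    have "(\<lambda>n. \<integral>v. ?q (?tail n) v \<partial>count_space V) \<longlonglongrightarrow> (\<integral>v. 0 \<partial>count_space V)"
    proof (rule integral_dominated_convergence[where w = "?q UNIV"])
      show "integrable (count_space V) (?q UNIV)"
        using abs[of UNIV] by (simp only: integrable_count_space_iff)
      show "AE v in count_space V. (\<lambda>n. ?q (?tail n) v) \<longlonglongrightarrow> 0"
      proof (intro AE_I2)
        fix v
        have "\<forall>\<^sub>F n in sequentially. \<theta> v \<notin> ?tail n"
        proof (cases "\<exists>k. \<theta> v \<in> B k")
          case True
          then obtain k where k: "\<theta> v \<in> B k" by blast
          have "\<theta> v \<notin> B i" if "i > k" for i
            using disj[of k i] k that by auto
          then have "\<theta> v \<notin> ?tail n" if "n > k" for n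
            using that unfolding UN_iff Bex_def atLeast_iff by (meson less_le_trans)
          then show ?thesis
            by (intro eventually_sequentiallyI[of "Suc k"]) (simp add: Suc_le_eq)
        qed simp
        then show "(\<lambda>n. ?q (?tail n) v) \<longlonglongrightarrow> 0"
          by (intro tendsto_eventually) (auto elim: eventually_mono)
      qed
    qed (auto simp: indicator_def)
    then show ?thesis
      unfolding integral_count_space_eq_infsum[OF abs] by simp
  qed
  then have "(\<lambda>n. sqrt (\<Sum>\<^sub>\<infinity>v\<in>V. ?q (?tail n) v)) \<longlonglongrightarrow> sqrt 0"
    by (rule tendsto_real_sqrt)
  then show "(\<lambda>n. l2_norm V (\<lambda>v. (\<Sum>k<n. the (?P (B k) f) v) - the (?P (\<Union>k. B k) f) v)) \<longlonglongrightarrow> 0"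
    unfolding tail l2_norm_def by simp
qed

text \<open>A spectral integral is specified by its domain and quadratic form only. Polarization
  with the vectors \<open>f + a e\<close>, where \<open>e\<close> is a basis vector, recovers each
  coordinate of the image of \<open>f\<close>.\<close>

lemma linear_operator_eqI:
  assumes lin: "linear_operator V S" "linear_operator V T"
    and dom: "dom S = dom T" "\<And>u. u \<in> V \<Longrightarrow> basis_vec u \<in> dom T"
    and form: "\<And>f. f \<in> dom T \<Longrightarrow> l2_inner V (the (S f)) f = l2_inner V (the (T f)) f"
  shows "S = T"
proof
  fix f
  show "S f = T f"
  proof (cases "f \<in> dom T")
    case True
    have sub: "dom T \<subseteq> l2 V"
      using lin(2) by (simp add: linear_operator_def)
    have l2: "the (S g) \<in> l2 V" "the (T g) \<in> l2 V" "g \<in> l2 V" if "g \<in> dom T" for g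
    proof -
      have "S g = Some (the (S g))" "T g = Some (the (T g))"
        using that that[folded dom(1)] by auto
      then show "the (S g) \<in> l2 V" "the (T g) \<in> l2 V" "g \<in> l2 V"
        using lin sub that unfolding linear_operator_def by (blast intro: ranI)+
    qed
    define D where "D g v = the (S g) v - the (T g) v" for g v
    have D_l2: "D g \<in> l2 V" if "g \<in> dom T" for g
      unfolding D_def using l2[OF that] by (intro l2_diff)
    have D_form: "l2_inner V (D g) g = 0" if "g \<in> dom T" for g
      using form[OF that] l2[OF that] unfolding D_def by (simp add: l2_inner_diff_left)
    have D_lin: "(\<lambda>v. g v + a * h v) \<in> dom T" "D (\<lambda>v. g v + a * h v) = (\<lambda>v. D g v + a * D h v)"
      if "g \<in> dom T" "h \<in> dom T" for a g h
    proof -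
      have *: "R (\<lambda>v. g v + a * h v) = Some (\<lambda>v. the (R g) v + a * the (R h) v)"
        if R: "linear_operator V R" "g \<in> dom R" "h \<in> dom R" for R
      proof -
        have "R (\<lambda>v. a * h v) = Some (\<lambda>v. a * the (R h) v)"
          using R by (simp add: linear_operator_def)
        moreover from this have "(\<lambda>v. a * h v) \<in> dom R" by blast
        ultimately show ?thesis
          using R by (simp add: linear_operator_def)
      qed
      show "(\<lambda>v. g v + a * h v) \<in> dom T"
        using *[OF lin(2) that] by blast
      show "D (\<lambda>v. g v + a * h v) = (\<lambda>v. D g v + a * D h v)"
        using *[OF lin(1)] *[OF lin(2) that] that dom(1)
        by (auto simp: D_def algebra_simps)
    qed
    have "the (S f) v = the (T f) v" for v
    proof (cases "v \<in> V")
      case v: True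
      let ?e = "basis_vec v :: 'a \<Rightarrow> complex"
      have polar: "cnj a * l2_inner V (D f) ?e + a * l2_inner V (D ?e) f = 0" for a
        using D_form[OF D_lin(1)[OF True dom(2)[OF v]], of a] D_form[OF True] D_form[OF dom(2)[OF v]]
        by (simp add: D_lin(2)[OF True dom(2)[OF v]] l2_inner_add_left l2_inner_add_right
            l2_inner_scale_left l2_inner_scale_right D_l2 l2 l2_scale l2_add True dom(2)[OF v])
      \<comment> \<open>The choice \<open>a = 1\<close> makes the two inner products opposite, the
        choice \<open>a = \<i>\<close> makes them equal.\<close>
      from polar[of 1] polar[of \<i>] have "l2_inner V (D f) ?e = 0"
        by (simp add: add_eq_0_iff)
      then show ?thesis
        using v by (simp add: l2_inner_basis_right D_def)
    next
      case False
      then show ?thesis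
        using l2[OF True] by (simp add: l2_zero_outside)
    qed
    then have "the (S f) = the (T f)" ..
    then show ?thesis
      using True dom(1) by (metis domIff option.expand)
  next
    case False
    then show ?thesis
      using dom(1) by (metis domIff)
  qed
qed

text \<open>The \<open>THE\<close> requires one \<open>T\<close> for all admissible
  \<open>P\<close>. The indicator measure supplies a candidate, and \<open>P_eq_indicator\<close>
  shows that every admissible \<open>P\<close> acts on Borel sets as that measure does, which fixes
  the domain and the quadratic form of \<open>T\<close>.\<close>

lemma borel_calculus_mult_op:
  assumes \<phi>: "\<phi> \<in> borel_measurable borel"
  shows "borel_calculus V \<phi> (mult_op V (\<lambda>v. of_real (\<theta> v))) = mult_op V (\<lambda>v. \<phi> (\<theta> v))"
proof -
  let ?N = "mult_op V (\<lambda>v. complex_of_real (\<theta> v))"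
  let ?T = "mult_op V (\<lambda>v. \<phi> (\<theta> v))"
  let ?P = "\<lambda>B. mult_op V (\<lambda>v. of_real (indicator B (\<theta> v)))"
  let ?Q = "\<lambda>T P. spectral_measure V P \<and> is_spectral_integral V P of_real ?N \<and>
                 is_spectral_integral V P \<phi> T"
  have "\<exists>P. ?Q ?T P"
  proof -
    interpret spectral V ?P
      by standard (rule spectral_measure_indicator)
    have P: "?P B f = Some (\<lambda>v. indicator B (\<theta> v) * f v)" if "f \<in> l2 V" for B f
      using that dom_mult_op_bounded[of V "\<lambda>v. of_real (indicator B (\<theta> v))" 1]
      by (subst mult_op_eq_Some) (auto simp: indicator_def)
    have "?Q ?T ?P"
      using spectral_measure spectral_integral_mult_op[OF P \<phi>]
        spectral_integral_mult_op[OF P, of of_real] by simp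
    then show ?thesis by (rule exI[of _ ?P])
  qed
  moreover have "T = ?T" if "\<exists>P. ?Q T P" for T
  proof -
    from that obtain P where P: "?Q T P" by blast
    interpret diagonal_spectral V P \<theta>
      using P by unfold_locales auto
    have T: "is_spectral_integral V P \<phi> T"
      using P by blast
    have T': "is_spectral_integral V P \<phi> ?T"
      using P_eq_indicator \<phi> by (intro spectral_integral_mult_op)
    show ?thesis
    proof (rule linear_operator_eqI[of V])
      show "linear_operator V T"
        using T unfolding is_spectral_integral_def by blast
      show dom: "dom T = dom ?T"
        using T T' by (simp add: is_spectral_integral_def)
      fix f assume f: "f \<in> dom ?T"
      have "l2_inner V (the (T f)) f = (\<integral>x. \<phi> x \<partial>scalar_measure V P f)"
        using T f[folded dom] unfolding is_spectral_integral_def by blast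
      also have "\<dots> = l2_inner V (the (?T f)) f"
        using T' f unfolding is_spectral_integral_def by simp
      finally show "l2_inner V (the (T f)) f = l2_inner V (the (?T f)) f" .
    qed (simp_all add: linear_mult_op basis_vec_dom_mult_op)
  qed
  ultimately show ?thesis
    unfolding borel_calculus_def by (rule the_equality)
qed

lemma exp_op_mult_op:
  "exp_op V z (mult_op V (\<lambda>v. of_real (\<theta> v))) = mult_op V (\<lambda>v. exp (z * of_real (\<theta> v)))"
  unfolding exp_op_def by (rule borel_calculus_mult_op) measurable

section \<open>Levels in directed trees\<close>

text \<open>With unique parents, walking against the edges is deterministic, so the longer path to
  \<open>v\<close> passes through the start of the shorter one.\<close>

lemma relpow_backward_unique:
  assumes parent: "\<And>u u' v. (u, v) \<in> E \<Longrightarrow> (u', v) \<in> E \<Longrightarrow> u = u'"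
    and "(a, v) \<in> E ^^ m" "(b, v) \<in> E ^^ (k + m)"
  shows "(b, a) \<in> E ^^ k"
  using assms(2,3)
proof (induction m arbitrary: v)
  case (Suc m)
  then obtain x y where "(a, x) \<in> E ^^ m" "(x, v) \<in> E" "(b, y) \<in> E ^^ (k + m)" "(y, v) \<in> E"
    by (metis add_Suc_right relpow_Suc_E)
  then show ?case
    using Suc.IH parent by blast
qed simp

text \<open>A closed walk of least positive length cannot repeat a vertex, since the segment between
  two visits would be a shorter closed walk.\<close>

lemma acyclic_if_no_circuit:
  assumes irrefl: "\<And>v. (v, v) \<notin> E"
    and no_circuit: "\<not> (\<exists>p. length p \<ge> 2 \<and> distinct p \<and>
             (\<forall>j. Suc j < length p \<longrightarrow> (p ! j, p ! Suc j) \<in> E) \<and> (last p, hd p) \<in> E)"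
  shows "acyclic E"
proof (rule acyclicI, rule allI, rule notI)
  fix a assume "(a, a) \<in> E\<^sup>+"
  then have ex: "\<exists>n a. n > 0 \<and> (a, a) \<in> E ^^ n"
    by (auto simp: trancl_power)
  define n where "n = (LEAST n. \<exists>a. n > 0 \<and> (a, a) \<in> E ^^ n)"
  have "\<exists>a. n > 0 \<and> (a, a) \<in> E ^^ n"
    unfolding n_def using ex by (rule LeastI_ex)
  then obtain a where n: "n > 0" "(a, a) \<in> E ^^ n" by blast
  have minimal: "n \<le> k" if "k > 0" "(b, b) \<in> E ^^ k" for k b
    unfolding n_def using that by (intro Least_le) blast
  obtain f where f: "f 0 = a" "f n = a" "\<And>i. i < n \<Longrightarrow> (f i, f (Suc i)) \<in> E"
    using n(2) by (auto simp: relpow_fun_conv)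
  have path: "(f i, f (i + k)) \<in> E ^^ k" if "i + k \<le> n" for i k
    using that
  proof (induction k)
    case (Suc k)
    then show ?case
      using f(3)[of "i + k"] by (intro relpow_Suc_I[of _ "f (i + k)"]) auto
  qed simp
  have "f i \<noteq> f j" if "i < j" "j < n" for i j
    using path[of i "j - i"] minimal[of "j - i" "f i"] that by auto
  then have "inj_on f {..<n}"
    by (intro linorder_inj_onI) auto
  then have dist: "distinct (map f [0..<n])"
    by (simp add: distinct_map atLeast0LessThan)
  \<comment> \<open>Circuits have at least two vertices by definition, so a loop has to be excluded
    separately.\<close>
  have "n \<noteq> 1"
    using f irrefl[of a] by (metis One_nat_def zero_less_one)
  then have len: "n \<ge> 2"
    using n(1) by simp
  \<comment> \<open>The list stops at \<open>f (n - 1)\<close> because \<open>f n\<close> is again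
    \<open>f 0\<close>; the last edge of the walk closes the circuit.\<close>
  have "(last (map f [0..<n]), hd (map f [0..<n])) \<in> E"
    using f(3)[of "n - 1"] f(1,2) n(1) by (simp add: last_map hd_map)
  then have "length (map f [0..<n]) \<ge> 2 \<and> distinct (map f [0..<n]) \<and>
      (\<forall>j. Suc j < length (map f [0..<n]) \<longrightarrow> (map f [0..<n] ! j, map f [0..<n] ! Suc j) \<in> E) \<and>
      (last (map f [0..<n]), hd (map f [0..<n])) \<in> E"
    using dist len f(3) by simp
  with no_circuit show False by blast
qed

lemma directed_tree_unique_parent:
  assumes "directed_tree V E" "(u, v) \<in> E" "(u', v) \<in> E"
  shows "u = u'"
proof -
  have "v \<in> V" "\<not> is_root V E v"
    using assms by (auto simp: directed_tree_def is_root_def)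
  then show ?thesis
    using assms by (auto simp: directed_tree_def)
qed

lemma directed_tree_acyclic:
  assumes "directed_tree V E"
  shows "acyclic E"
proof (rule acyclic_if_no_circuit)
  show "(v, v) \<notin> E" for v
    using assms by (auto simp: directed_tree_def)
  show "\<not> (\<exists>p. length p \<ge> 2 \<and> distinct p \<and>
      (\<forall>j. Suc j < length p \<longrightarrow> (p ! j, p ! Suc j) \<in> E) \<and> (last p, hd p) \<in> E)"
    using assms unfolding directed_tree_def by (elim conjE)
qed

lemma directed_tree_par:
  assumes "directed_tree V E" "v \<in> nonroots V E"
  shows "(par E v, v) \<in> E"
proof -
  have "\<exists>!u. (u, v) \<in> E"
    using assms by (auto simp: directed_tree_def nonroots_def)
  then show ?thesis
    unfolding par_def by (rule theI')
qed

text \<open>Induction along an undirected path from \<open>u\<close> to \<open>v\<close>, carrying a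
  vertex from which both \<open>u\<close> and the current vertex are reached. A downward step merely
  lengthens the second path.\<close>

lemma directed_tree_common_ancestor:
  assumes tree: "directed_tree V E" and "u \<in> V" "v \<in> V"
  obtains a m n where "(a, u) \<in> E ^^ m" "(a, v) \<in> E ^^ n"
proof -
  have "\<exists>a m n. (a, u) \<in> E ^^ m \<and> (a, v) \<in> E ^^ n"
  proof (cases "u = v")
    case True
    have "(u, u) \<in> E ^^ 0 \<and> (u, v) \<in> E ^^ 0"
      using True by simp
    then show ?thesis by blast
  next
    case False
    then obtain p where p: "length p \<ge> 2" "hd p = u" "last p = v"
      "\<And>j. Suc j < length p \<Longrightarrow> (p ! j, p ! Suc j) \<in> E \<or> (p ! Suc j, p ! j) \<in> E"
    proof -
      have "\<exists>p. length p \<ge> 2 \<and> set p \<subseteq> V \<and> hd p = u \<and> last p = v \<and>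
          (\<forall>j. Suc j < length p \<longrightarrow> (p ! j, p ! Suc j) \<in> E \<or> (p ! Suc j, p ! j) \<in> E)"
        using assms False by (simp add: directed_tree_def)
      then show ?thesis
        using that by blast
    qed
    have ancestor: "\<exists>a m n. (a, u) \<in> E ^^ m \<and> (a, p ! j) \<in> E ^^ n" if "j < length p" for j
      using that
    proof (induction j)
      case 0
      have "(u, u) \<in> E ^^ 0 \<and> (u, p ! 0) \<in> E ^^ 0"
        using p(1,2) by (cases p) auto
      then show ?case by blast
    next
      case (Suc j)
      then obtain a m n where IH: "(a, u) \<in> E ^^ m" "(a, p ! j) \<in> E ^^ n"
        by auto
      from p(4)[OF Suc.prems] show ?case
      proof
        assume "(p ! j, p ! Suc j) \<in> E"
        then show ?thesis
          using IH(1) relpow_Suc_I[OF IH(2)] by blast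
      next
        assume edge: "(p ! Suc j, p ! j) \<in> E"
        show ?thesis
        \<comment> \<open>For an upward step with \<open>n = 0\<close> the ancestor is the current
          vertex, and its parent takes over. Otherwise the path to the current vertex enters through
          that same parent, and dropping its last edge suffices.\<close>
        proof (cases n)
          case 0
          then have "(p ! Suc j, u) \<in> E ^^ Suc m \<and> (p ! Suc j, p ! Suc j) \<in> E ^^ 0"
            using IH relpow_Suc_I2[OF edge] by auto
          then show ?thesis by blast
        next
          case (Suc n')
          then obtain x where "(a, x) \<in> E ^^ n'" "(x, p ! j) \<in> E"
            using IH(2) by (metis relpow_Suc_E)
          moreover from this have "x = p ! Suc j"
            using edge directed_tree_unique_parent[OF tree] by blast
          ultimately show ?thesis
            using IH(1) by blast
        qed
      qed
    qed
    have "length p - 1 < length p" "p ! (length p - 1) = v"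
      using p(1,3) last_conv_nth[of p] by (cases p; simp)+
    then show ?thesis
      using ancestor[of "length p - 1"] by (simp only:)
  qed
  with that show ?thesis by blast
qed

text \<open>Makes the level well defined. Of two common ancestors, the one with the longer path to
  \<open>u\<close> reaches the other in some \<open>k\<close> steps, hence reaches \<open>v\<close>
  through it; a path to \<open>v\<close> of any other length would produce a cycle.\<close>

lemma directed_tree_level_unique:
  assumes tree: "directed_tree V E"
    and a: "(a, u) \<in> E ^^ m" "(a, v) \<in> E ^^ n"
    and b: "(b, u) \<in> E ^^ m'" "(b, v) \<in> E ^^ n'"
  shows "int n - int m = int n' - int m'"
proof -
  have unique: "(y, x) \<in> E ^^ k" if "(x, w) \<in> E ^^ i" "(y, w) \<in> E ^^ (k + i)" for x y w i k
    by (rule relpow_backward_unique[OF _ that]) (rule directed_tree_unique_parent[OF tree])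
  have cycle: "k = 0" if "(x, x) \<in> E ^^ k" for x k
  proof (rule ccontr)
    assume "k \<noteq> 0"
    then have "(x, x) \<in> E\<^sup>+"
      using that by (auto simp: trancl_power)
    then show False
      using directed_tree_acyclic[OF tree] by (simp add: acyclic_def)
  qed
  have shift: "n' = k + n"
    if "(a, u) \<in> E ^^ m" "(a, v) \<in> E ^^ n" "(b, u) \<in> E ^^ (k + m)" "(b, v) \<in> E ^^ n'"
    for a b m n n' k
  proof -
    have "(b, a) \<in> E ^^ k"
      using that(1,3) by (rule unique)
    then have bv: "(b, v) \<in> E ^^ (k + n)"
      using that(2) unfolding relpow_add by (rule relcompI)
    show ?thesis
    proof (cases "n' \<le> k + n")
      case True
      then show ?thesis
        using cycle[OF unique[OF that(4), of b "k + n - n'"]] bv by simp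
    next
      case False
      then show ?thesis
        using cycle[OF unique[OF bv, of b "n' - (k + n)"]] that(4) by simp
    qed
  qed
  show ?thesis
  proof (cases "m \<le> m'")
    case True
    then show ?thesis
      using shift[OF a, of b "m' - m" n'] b by simp
  next
    case False
    then show ?thesis
      using shift[OF b, of a "m - m'" n] a by simp
  qed
qed

lemma directed_tree_level_function:
  assumes tree: "directed_tree V E"
  obtains d :: "'v \<Rightarrow> int" where "\<And>v. v \<in> nonroots V E \<Longrightarrow> d v = d (par E v) + 1"
proof -
  obtain r where r: "r \<in> V"
    using tree by (auto simp: directed_tree_def)
  \<comment> \<open>The reference vertex \<open>r\<close> is arbitrary, since a root may fail to
    exist. Levels are therefore integers: from a common ancestor, the distance down to
    \<open>v\<close> minus the distance down to \<open>r\<close>.\<close>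
  define d where "d v = (THE l. \<exists>a m n. (a, r) \<in> E ^^ m \<and> (a, v) \<in> E ^^ n \<and> l = int n - int m)"
    for v
  have d_eq: "d v = int n - int m" if "(a, r) \<in> E ^^ m" "(a, v) \<in> E ^^ n" for a v m n
    unfolding d_def using that directed_tree_level_unique[OF tree] by (intro the_equality) blast+
  have "d v = d (par E v) + 1" if v: "v \<in> nonroots V E" for v
  proof -
    have edge: "(par E v, v) \<in> E"
      using tree v by (rule directed_tree_par)
    then have "par E v \<in> V"
      using tree by (auto simp: directed_tree_def)
    then obtain a m n where "(a, r) \<in> E ^^ m" "(a, par E v) \<in> E ^^ n"
      using directed_tree_common_ancestor[OF tree r] by blast
    moreover from this edge have "(a, v) \<in> E ^^ Suc n"
      by (intro relpow_Suc_I)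
    ultimately show ?thesis
      using d_eq[of a m v "Suc n"] d_eq[of a m "par E v" n] by simp
  qed
  then show ?thesis by (rule that)
qed

section \<open>Conjugation of the weighted shift\<close>

text \<open>At a vertex \<open>v\<close> other than the root, the shift reads its argument at
  \<open>par E v\<close>, so the conjugated operator picks up exactly the factor
  \<open>q v * p (par E v)\<close>.\<close>

lemma mult_op_weighted_shift_conjugation:
  assumes unimodular: "\<And>v. cmod (p v) = 1" "\<And>v. cmod (q v) = 1" "cmod a = 1"
    and phase: "\<And>v. v \<in> nonroots V E \<Longrightarrow> q v * p (par E v) = a"
  shows "mult_op V q \<circ>\<^sub>m weighted_shift V E w \<circ>\<^sub>m mult_op V p = scale_op a (weighted_shift V E w)"
proof
  fix f
  show "(mult_op V q \<circ>\<^sub>m weighted_shift V E w \<circ>\<^sub>m mult_op V p) f = scale_op a (weighted_shift V E w) f"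
  proof (cases "f \<in> l2 V")
    case False
    then show ?thesis
      by (simp add: map_comp_def mult_op_def scale_op_def weighted_shift_def)
  next
    case True
    define g where "g = (\<lambda>v. p v * f v)"
    let ?Sf = "shift_fun V E w f" and ?Sg = "shift_fun V E w g"
    have dom: "dom (mult_op V m) = l2 V" if "\<And>v. cmod (m v) = 1" for m
      using that by (intro dom_mult_op_bounded[of V m 1]) simp
    have mult: "mult_op V m h = Some (\<lambda>v. m v * h v)" if "h \<in> l2 V" "\<And>v. cmod (m v) = 1" for m h
      using that dom[of m] by (simp add: mult_op_eq_Some)
    have g: "mult_op V p f = Some g" "g \<in> l2 V"
      using mult[of f p] True unimodular(1)
      by (auto simp: g_def norm_mult l2_zero_outside intro: l2_dominated[OF True, of _ 1])
    have eq: "q v * ?Sg v = a * ?Sf v" for v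
    proof (cases "v \<in> nonroots V E")
      case True
      have "q v * ?Sg v = (q v * p (par E v)) * ?Sf v"
        using True by (simp add: shift_fun_def g_def)
      then show ?thesis
        using phase[OF True] by simp
    qed (simp add: shift_fun_def)
    \<comment> \<open>Unimodular factors leave absolute values unchanged, which is what makes the
      domains of the two sides equal.\<close>
    have norm: "cmod (?Sg v) = cmod (?Sf v)" for v
      using arg_cong[OF eq[of v], of cmod] unimodular by (simp add: norm_mult)
    have outside: "?Sf v = 0" "?Sg v = 0" if "v \<notin> V" for v
      using that by (simp_all add: shift_fun_def nonroots_def)
    have iff: "?Sg \<in> l2 V \<longleftrightarrow> ?Sf \<in> l2 V"
      by (simp add: l2_def norm outside)
    show ?thesis
    proof (cases "?Sf \<in> l2 V")
      case True
      then show ?thesis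
        using \<open>f \<in> l2 V\<close> g iff mult[OF _ unimodular(2), of ?Sg] eq
        by (simp add: map_comp_def scale_op_def weighted_shift_def)
    next
      case False
      then show ?thesis
        using \<open>f \<in> l2 V\<close> g iff by (simp add: map_comp_def scale_op_def weighted_shift_def)
    qed
  qed
qed

theorem theorem3p3p1:
  fixes V :: "'v set" and E :: "('v \<times> 'v) set" and w :: "'v \<Rightarrow> complex" and c :: real
  assumes "directed_tree V E"
  shows "\<exists>\<theta> :: 'v \<Rightarrow> real.
           (\<exists>!N. selfadjoint_diagonal V \<theta> N) \<and>
           (\<forall>N. selfadjoint_diagonal V \<theta> N \<longrightarrow>
              (\<forall>t::real.
                 exp_op V (- (\<i> * of_real t)) N \<circ>\<^sub>m weighted_shift V E w \<circ>\<^sub>m exp_op V (\<i> * of_real t) N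
                 = scale_op (exp (\<i> * of_real t * of_real c)) (weighted_shift V E w)))"
proof -
  obtain d :: "'v \<Rightarrow> int" where d: "\<And>v. v \<in> nonroots V E \<Longrightarrow> d v = d (par E v) + 1"
    using directed_tree_level_function[OF assms] by blast
  define \<theta> where "\<theta> v = - c * real_of_int (d v)" for v
  have step: "\<theta> (par E v) - \<theta> v = c" if "v \<in> nonroots V E" for v
    using d[OF that] by (simp add: \<theta>_def algebra_simps)
  have "mult_op V (\<lambda>v. exp (- (\<i> * of_real t) * of_real (\<theta> v))) \<circ>\<^sub>m weighted_shift V E w \<circ>\<^sub>m
      mult_op V (\<lambda>v. exp (\<i> * of_real t * of_real (\<theta> v)))
      = scale_op (exp (\<i> * of_real t * of_real c)) (weighted_shift V E w)" for t :: real
  proof (rule mult_op_weighted_shift_conjugation)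
    fix v assume "v \<in> nonroots V E"
    then have c_eq: "complex_of_real c = of_real (\<theta> (par E v)) - of_real (\<theta> v)"
      using step by (simp flip: of_real_diff)
    show "exp (- (\<i> * of_real t) * of_real (\<theta> v)) * exp (\<i> * of_real t * of_real (\<theta> (par E v)))
        = exp (\<i> * of_real t * of_real c)"
      unfolding c_eq by (simp add: algebra_simps flip: exp_add)
  qed simp_all
  \<comment> \<open>By \<open>selfadjoint_diagonal_iff\<close> the condition on \<open>N\<close> is
    an equation. This settles unique existence and lets \<open>exp_op_mult_op\<close> evaluate both
    exponentials.\<close>
  then show ?thesis
    by (intro exI[of _ \<theta>]) (simp add: selfadjoint_diagonal_iff exp_op_mult_op)
qed

end
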